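(* Let $(H,B,\varphi_{B})$ be a Hopf bracoid in ${\sf C}$ such that $\varphi_{B}\colon H\otimes B\to B$ is a coalgebra morphism. If $$(\Phi_{B}\otimes H)\circ(H\otimes c_{H,B})\circ((c_{H,H}\circ \delta_{H})\otimes B)=(\Phi_{B}\otimes H)\circ(H\otimes c_{H,B})\circ(\delta_{H}\otimes B),$$ then $\Phi_{B}\colon H\otimes B\to B$ is a coalgebra morphism.
   Context: ${\sf C}$ is a strict braided monoidal category with tensor product $\otimes$, unit object $K$ and braiding $c$. For an object $P$ and a morphism $f$, write $P\otimes f$ for $id_P\otimes f$ and $f\otimes P$ for $f\otimes id_P$. Algebras $(A,\eta_A,\mu_A)$, coalgebras $(D,\varepsilon_D,\delta_D)$, and Hopf algebras $X=(X,\eta_X,\mu_X,\varepsilon_X,\delta_X,\lambda_X)$ (with antipode $\lambda_X$) are taken in ${\sf C}$; tensor products have structures $\mu_{A\otimes B}=(\mu_A\otimes\mu_B)\circ(A\otimes c_{B,A}\otimes B)$ and $\delta_{D\otimes E}=(D\otimes c_{D,E}\otimes E)\circ(\delta_D\otimes\delta_E)$, with the obvious units and counits. A Hopf bracoid in ${\sf C}$ is a triple $(H,B,\varphi_B)$ where $H,B$ are Hopf algebras in ${\sf C}$ and $(B,\varphi_B)$ is a left $H$-module such that $$\varphi_{B}\circ(H\otimes\mu_{B})=\mu_{B}\circ (\varphi_{B}\otimes\Phi_{B})\circ(H\otimes c_{H,B}\otimes B)\circ(\delta_{H}\otimes B\otimes B),$$ where $\Phi_{B}= \mu_{B}\circ((\lambda_{B}\circ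 u_{\varphi_{B}})\otimes\varphi_{B})\circ(\delta_{H}\otimes B)$ and $u_{\varphi_{B}}=\varphi_{B}\circ(H\otimes\eta_{B})$. *)

theory Defs
  imports Main
begin

section \<open>Strict braided monoidal categories\<close>

text \<open>
  Objects and morphisms are carried by the sets \<open>Obj\<close> and \<open>Arr\<close>; all operations are constrained
  only on these. Composition is written in the usual order and constrained only for composable
  pairs. Strictness means that \<open>\<odot>\<close> (tensor of objects) and \<open>\<otimes>\<close> (tensor of
  morphisms) are associative and unital on the nose. The whiskerings \<open>P \<otimes> f\<close> and
  \<open>f \<otimes> P\<close> of the literature are \<open>\<one> P \<otimes> f\<close> and \<open>f \<otimes> \<one> P\<close>, where
  \<open>\<one> P\<close> is the identity of \<open>P\<close>.
\<close>

record ('o, 'm) braided_data =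
  Obj :: "'o set"
  Arr :: "'m set"
  Dom :: "'m \<Rightarrow> 'o"
  Cod :: "'m \<Rightarrow> 'o"
  Idn :: "'o \<Rightarrow> 'm"  ("\<one>\<index>")
  Comp :: "'m \<Rightarrow> 'm \<Rightarrow> 'm"  (infixr "\<cdot>\<index>" 65)
  TObj :: "'o \<Rightarrow> 'o \<Rightarrow> 'o"  (infixr "\<odot>\<index>" 70)
  TArr :: "'m \<Rightarrow> 'm \<Rightarrow> 'm"  (infixr "\<otimes>\<index>" 70)
  UObj :: "'o"  ("\<K>\<index>")
  Braid :: "'o \<Rightarrow> 'o \<Rightarrow> 'm"  ("\<c>\<index>")

definition hom :: "('o, 'm, 'z) braided_data_scheme \<Rightarrow> 'o \<Rightarrow> 'o \<Rightarrow> 'm set" where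
  "hom C X Y = {f \<in> Arr C. Dom C f = X \<and> Cod C f = Y}"

locale category =
  fixes C :: "('o, 'm, 'z) braided_data_scheme" (structure)
  assumes dom_Obj: "f \<in> Arr C \<Longrightarrow> Dom C f \<in> Obj C"
    and cod_Obj: "f \<in> Arr C \<Longrightarrow> Cod C f \<in> Obj C"
    and id_hom: "X \<in> Obj C \<Longrightarrow> \<one> X \<in> hom C X X"
    and comp_hom: "\<lbrakk>g \<in> hom C Y Z; f \<in> hom C X Y\<rbrakk> \<Longrightarrow> g \<cdot> f \<in> hom C X Z"
    and id_left: "f \<in> hom C X Y \<Longrightarrow> \<one> Y \<cdot> f = f"
    and id_right: "f \<in> hom C X Y \<Longrightarrow> f \<cdot> \<one> X = f"
    and comp_assoc: "\<lbrakk>h \<in> hom C Y Z; g \<in> hom C X Y; f \<in> hom C W X\<rbrakk>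
      \<Longrightarrow> (h \<cdot> g) \<cdot> f = h \<cdot> (g \<cdot> f)"

locale strict_monoidal_category = category C
  for C :: "('o, 'm, 'z) braided_data_scheme" (structure) +
  assumes unit_Obj: "\<K> \<in> Obj C"
    and tobj_Obj: "\<lbrakk>X \<in> Obj C; Y \<in> Obj C\<rbrakk> \<Longrightarrow> X \<odot> Y \<in> Obj C"
    and tobj_assoc: "\<lbrakk>X \<in> Obj C; Y \<in> Obj C; Z \<in> Obj C\<rbrakk> \<Longrightarrow> (X \<odot> Y) \<odot> Z = X \<odot> (Y \<odot> Z)"
    and tobj_unit_left: "X \<in> Obj C \<Longrightarrow> \<K> \<odot> X = X"
    and tobj_unit_right: "X \<in> Obj C \<Longrightarrow> X \<odot> \<K> = X"
    and tarr_hom: "\<lbrakk>f \<in> hom C X X'; g \<in> hom C Y Y'\<rbrakk> \<Longrightarrow> f \<otimes> g \<in> hom C (X \<odot> Y) (X' \<odot> Y')"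
    and tarr_id: "\<lbrakk>X \<in> Obj C; Y \<in> Obj C\<rbrakk> \<Longrightarrow> \<one> X \<otimes> \<one> Y = \<one> (X \<odot> Y)"
    and tarr_comp: "\<lbrakk>f' \<in> hom C X' X''; f \<in> hom C X X'; g' \<in> hom C Y' Y''; g \<in> hom C Y Y'\<rbrakk>
      \<Longrightarrow> (f' \<cdot> f) \<otimes> (g' \<cdot> g) = (f' \<otimes> g') \<cdot> (f \<otimes> g)"
    and tarr_assoc: "\<lbrakk>f \<in> Arr C; g \<in> Arr C; h \<in> Arr C\<rbrakk> \<Longrightarrow> (f \<otimes> g) \<otimes> h = f \<otimes> (g \<otimes> h)"
    and tarr_unit_left: "f \<in> Arr C \<Longrightarrow> \<one> \<K> \<otimes> f = f"
    and tarr_unit_right: "f \<in> Arr C \<Longrightarrow> f \<otimes> \<one> \<K> = f"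

definition is_iso :: "('o, 'm, 'z) braided_data_scheme \<Rightarrow> 'o \<Rightarrow> 'o \<Rightarrow> 'm \<Rightarrow> bool" where
  "is_iso C X Y f \<longleftrightarrow> f \<in> hom C X Y \<and>
     (\<exists>g \<in> hom C Y X. Comp C g f = Idn C X \<and> Comp C f g = Idn C Y)"

text \<open>The last two axioms are the hexagon identities, with identity associators.\<close>

locale strict_braided_monoidal_category = strict_monoidal_category C
  for C :: "('o, 'm, 'z) braided_data_scheme" (structure) +
  assumes braid_iso: "\<lbrakk>X \<in> Obj C; Y \<in> Obj C\<rbrakk> \<Longrightarrow> is_iso C (X \<odot> Y) (Y \<odot> X) (\<c> X Y)"
    and braid_natural: "\<lbrakk>f \<in> hom C X X'; g \<in> hom C Y Y'\<rbrakk>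
      \<Longrightarrow> \<c> X' Y' \<cdot> (f \<otimes> g) = (g \<otimes> f) \<cdot> \<c> X Y"
    and hexagon_right: "\<lbrakk>X \<in> Obj C; Y \<in> Obj C; Z \<in> Obj C\<rbrakk>
      \<Longrightarrow> \<c> X (Y \<odot> Z) = (\<one> Y \<otimes> \<c> X Z) \<cdot> (\<c> X Y \<otimes> \<one> Z)"
    and hexagon_left: "\<lbrakk>X \<in> Obj C; Y \<in> Obj C; Z \<in> Obj C\<rbrakk>
      \<Longrightarrow> \<c> (X \<odot> Y) Z = (\<c> X Z \<otimes> \<one> Y) \<cdot> (\<one> X \<otimes> \<c> Y Z)"

section \<open>Algebras, coalgebras, Hopf algebras\<close>

record ('o, 'm) coalgebra =
  ob :: "'o"
  counit :: "'m"
  comult :: "'m"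

text \<open>
  A Hopf algebra record extends its underlying coalgebra, so that a Hopf algebra can be used
  wherever a coalgebra is expected.
\<close>

record ('o, 'm) hopf = "('o, 'm) coalgebra" +
  unit :: "'m"
  mult :: "'m"
  antipode :: "'m"

definition is_coalgebra ::
  "('o, 'm, 'z) braided_data_scheme \<Rightarrow> ('o, 'm, 'y) coalgebra_scheme \<Rightarrow> bool" where
  "is_coalgebra C D \<longleftrightarrow>
     ob D \<in> Obj C \<and>
     counit D \<in> hom C (ob D) \<K>\<^bsub>C\<^esub> \<and>
     comult D \<in> hom C (ob D) (ob D \<odot>\<^bsub>C\<^esub> ob D) \<and>
     (counit D \<otimes>\<^bsub>C\<^esub> \<one>\<^bsub>C\<^esub> (ob D)) \<cdot>\<^bsub>C\<^esub> comult D = \<one>\<^bsub>C\<^esub> (ob D) \<and>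
     (\<one>\<^bsub>C\<^esub> (ob D) \<otimes>\<^bsub>C\<^esub> counit D) \<cdot>\<^bsub>C\<^esub> comult D = \<one>\<^bsub>C\<^esub> (ob D) \<and>
     (comult D \<otimes>\<^bsub>C\<^esub> \<one>\<^bsub>C\<^esub> (ob D)) \<cdot>\<^bsub>C\<^esub> comult D =
       (\<one>\<^bsub>C\<^esub> (ob D) \<otimes>\<^bsub>C\<^esub> comult D) \<cdot>\<^bsub>C\<^esub> comult D"

definition is_algebra ::
  "('o, 'm, 'z) braided_data_scheme \<Rightarrow> 'o \<Rightarrow> 'm \<Rightarrow> 'm \<Rightarrow> bool" where
  "is_algebra C A \<eta> \<mu> \<longleftrightarrow>
     A \<in> Obj C \<and>
     \<eta> \<in> hom C \<K>\<^bsub>C\<^esub> A \<and>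
     \<mu> \<in> hom C (A \<odot>\<^bsub>C\<^esub> A) A \<and>
     \<mu> \<cdot>\<^bsub>C\<^esub> (\<eta> \<otimes>\<^bsub>C\<^esub> \<one>\<^bsub>C\<^esub> A) = \<one>\<^bsub>C\<^esub> A \<and>
     \<mu> \<cdot>\<^bsub>C\<^esub> (\<one>\<^bsub>C\<^esub> A \<otimes>\<^bsub>C\<^esub> \<eta>) = \<one>\<^bsub>C\<^esub> A \<and>
     \<mu> \<cdot>\<^bsub>C\<^esub> (\<mu> \<otimes>\<^bsub>C\<^esub> \<one>\<^bsub>C\<^esub> A) = \<mu> \<cdot>\<^bsub>C\<^esub> (\<one>\<^bsub>C\<^esub> A \<otimes>\<^bsub>C\<^esub> \<mu>)"

definition unit_coalgebra :: "('o, 'm, 'z) braided_data_scheme \<Rightarrow> ('o, 'm) coalgebra" where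
  "unit_coalgebra C = \<lparr>ob = \<K>\<^bsub>C\<^esub>, counit = \<one>\<^bsub>C\<^esub> \<K>\<^bsub>C\<^esub>, comult = \<one>\<^bsub>C\<^esub> \<K>\<^bsub>C\<^esub>\<rparr>"

definition tensor_coalgebra ::
  "('o, 'm, 'z) braided_data_scheme \<Rightarrow> ('o, 'm, 'y) coalgebra_scheme \<Rightarrow>
   ('o, 'm, 'x) coalgebra_scheme \<Rightarrow> ('o, 'm) coalgebra" where
  "tensor_coalgebra C D E =
     \<lparr>ob = ob D \<odot>\<^bsub>C\<^esub> ob E,
      counit = counit D \<otimes>\<^bsub>C\<^esub> counit E,
      comult = (\<one>\<^bsub>C\<^esub> (ob D) \<otimes>\<^bsub>C\<^esub> \<c>\<^bsub>C\<^esub> (ob D) (ob E) \<otimes>\<^bsub>C\<^esub> \<one>\<^bsub>C\<^esub> (ob E))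
        \<cdot>\<^bsub>C\<^esub> (comult D \<otimes>\<^bsub>C\<^esub> comult E)\<rparr>"

definition coalgebra_morphism ::
  "('o, 'm, 'z) braided_data_scheme \<Rightarrow> ('o, 'm, 'y) coalgebra_scheme \<Rightarrow>
   ('o, 'm, 'x) coalgebra_scheme \<Rightarrow> 'm \<Rightarrow> bool" where
  "coalgebra_morphism C D E f \<longleftrightarrow>
     f \<in> hom C (ob D) (ob E) \<and>
     counit E \<cdot>\<^bsub>C\<^esub> f = counit D \<and>
     comult E \<cdot>\<^bsub>C\<^esub> f = (f \<otimes>\<^bsub>C\<^esub> f) \<cdot>\<^bsub>C\<^esub> comult D"

text \<open>
  The bialgebra compatibility is that unit and multiplication are coalgebra morphisms; unfolded,
  this is the same list of four equations as counit and comultiplication being algebra morphisms.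
\<close>

definition is_hopf_algebra ::
  "('o, 'm, 'z) braided_data_scheme \<Rightarrow> ('o, 'm, 'y) hopf_scheme \<Rightarrow> bool" where
  "is_hopf_algebra C X \<longleftrightarrow>
     is_algebra C (ob X) (unit X) (mult X) \<and>
     is_coalgebra C X \<and>
     coalgebra_morphism C (unit_coalgebra C) X (unit X) \<and>
     coalgebra_morphism C (tensor_coalgebra C X X) X (mult X) \<and>
     antipode X \<in> hom C (ob X) (ob X) \<and>
     mult X \<cdot>\<^bsub>C\<^esub> (antipode X \<otimes>\<^bsub>C\<^esub> \<one>\<^bsub>C\<^esub> (ob X)) \<cdot>\<^bsub>C\<^esub> comult X = unit X \<cdot>\<^bsub>C\<^esub> counit X \<and>
     mult X \<cdot>\<^bsub>C\<^esub> (\<one>\<^bsub>C\<^esub> (ob X) \<otimes>\<^bsub>C\<^esub> antipode X) \<cdot>\<^bsub>C\<^esub> comult X = unit X \<cdot>\<^bsub>C\<^esub> counit X"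

section \<open>Hopf bracoids\<close>

definition is_left_module ::
  "('o, 'm, 'z) braided_data_scheme \<Rightarrow> ('o, 'm, 'y) hopf_scheme \<Rightarrow> 'o \<Rightarrow> 'm \<Rightarrow> bool" where
  "is_left_module C H M \<phi> \<longleftrightarrow>
     M \<in> Obj C \<and>
     \<phi> \<in> hom C (ob H \<odot>\<^bsub>C\<^esub> M) M \<and>
     \<phi> \<cdot>\<^bsub>C\<^esub> (unit H \<otimes>\<^bsub>C\<^esub> \<one>\<^bsub>C\<^esub> M) = \<one>\<^bsub>C\<^esub> M \<and>
     \<phi> \<cdot>\<^bsub>C\<^esub> (\<one>\<^bsub>C\<^esub> (ob H) \<otimes>\<^bsub>C\<^esub> \<phi>) = \<phi> \<cdot>\<^bsub>C\<^esub> (mult H \<otimes>\<^bsub>C\<^esub> \<one>\<^bsub>C\<^esub> M)"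

definition bracoid_u ::
  "('o, 'm, 'z) braided_data_scheme \<Rightarrow> ('o, 'm, 'y) hopf_scheme \<Rightarrow>
   ('o, 'm, 'x) hopf_scheme \<Rightarrow> 'm \<Rightarrow> 'm" where
  "bracoid_u C H B \<phi> = \<phi> \<cdot>\<^bsub>C\<^esub> (\<one>\<^bsub>C\<^esub> (ob H) \<otimes>\<^bsub>C\<^esub> unit B)"

definition bracoid_Phi ::
  "('o, 'm, 'z) braided_data_scheme \<Rightarrow> ('o, 'm, 'y) hopf_scheme \<Rightarrow>
   ('o, 'm, 'x) hopf_scheme \<Rightarrow> 'm \<Rightarrow> 'm" where
  "bracoid_Phi C H B \<phi> =
     mult B \<cdot>\<^bsub>C\<^esub> ((antipode B \<cdot>\<^bsub>C\<^esub> bracoid_u C H B \<phi>) \<otimes>\<^bsub>C\<^esub> \<phi>)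
       \<cdot>\<^bsub>C\<^esub> (comult H \<otimes>\<^bsub>C\<^esub> \<one>\<^bsub>C\<^esub> (ob B))"

definition hopf_bracoid ::
  "('o, 'm, 'z) braided_data_scheme \<Rightarrow> ('o, 'm, 'y) hopf_scheme \<Rightarrow>
   ('o, 'm, 'x) hopf_scheme \<Rightarrow> 'm \<Rightarrow> bool" where
  "hopf_bracoid C H B \<phi> \<longleftrightarrow>
     is_hopf_algebra C H \<and>
     is_hopf_algebra C B \<and>
     is_left_module C H (ob B) \<phi> \<and>
     \<phi> \<cdot>\<^bsub>C\<^esub> (\<one>\<^bsub>C\<^esub> (ob H) \<otimes>\<^bsub>C\<^esub> mult B) =
       mult B \<cdot>\<^bsub>C\<^esub> (\<phi> \<otimes>\<^bsub>C\<^esub> bracoid_Phi C H B \<phi>)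
         \<cdot>\<^bsub>C\<^esub> (\<one>\<^bsub>C\<^esub> (ob H) \<otimes>\<^bsub>C\<^esub> \<c>\<^bsub>C\<^esub> (ob H) (ob B) \<otimes>\<^bsub>C\<^esub> \<one>\<^bsub>C\<^esub> (ob B))
         \<cdot>\<^bsub>C\<^esub> (comult H \<otimes>\<^bsub>C\<^esub> \<one>\<^bsub>C\<^esub> (ob B) \<otimes>\<^bsub>C\<^esub> \<one>\<^bsub>C\<^esub> (ob B))"

end

theory Submission
  imports Defs
begin

text \<open>
  Write \<open>\<sigma>\<close> for \<open>\<lambda>\<^sub>B \<circ> u\<close> and use Sweedler notation with the braidings suppressed, so that
  \<open>\<Phi>(h \<otimes> b) = \<sigma>(h\<^sub>1) \<phi>(h\<^sub>2 \<otimes> b)\<close>. The antipode is anti-comultiplicative (uniqueness of convolution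
  inverses in \<open>Hom(B, B \<otimes> B)\<close>) and \<open>u\<close> is a coalgebra morphism, hence
  \<open>\<delta>(\<Phi>(h \<otimes> b)) = \<sigma>(h\<^sub>2) \<phi>(h\<^sub>3 \<otimes> b\<^sub>1) \<otimes> \<sigma>(h\<^sub>1) \<phi>(h\<^sub>4 \<otimes> b\<^sub>2) = \<Phi>(h\<^sub>2 \<otimes> b\<^sub>1) \<otimes> \<sigma>(h\<^sub>1) \<phi>(h\<^sub>3 \<otimes> b\<^sub>2)\<close>.
  The cocommutativity hypothesis exchanges \<open>h\<^sub>1\<close> and \<open>h\<^sub>2\<close>, and coassociativity turns the result into
  \<open>\<Phi>(h\<^sub>1 \<otimes> b\<^sub>1) \<otimes> \<Phi>(h\<^sub>2 \<otimes> b\<^sub>2)\<close>. In the braided setting, naturality and the hexagons show that the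
  strand of \<open>h\<^sub>1\<close> crosses \<open>h\<^sub>2\<close>, \<open>h\<^sub>3\<close>, \<open>b\<^sub>1\<close> in this order, after \<open>h\<^sub>4\<close> has crossed \<open>b\<^sub>1\<close>; so the
  two strands that have to be exchanged meet exactly as in the hypothesis.
\<close>

section \<open>Calculus of typed morphisms\<close>

context category
begin

lemma homI: "\<lbrakk>f \<in> Arr C; Dom C f = X; Cod C f = Y\<rbrakk> \<Longrightarrow> f \<in> hom C X Y"
  by (simp add: hom_def)

text \<open>Typing is phrased with \<open>Dom\<close> and \<open>Cod\<close> equations instead of
  membership in \<open>hom\<close>, so that the type of a composite is computed from its parts by
  rewriting.\<close>

lemma comp_props:
  assumes "g \<in> Arr C" "f \<in> Arr C" "Dom C g = Cod C f"
  shows arr_comp: "g \<cdot> f \<in> Arr C"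
    and dom_comp: "Dom C (g \<cdot> f) = Dom C f"
    and cod_comp: "Cod C (g \<cdot> f) = Cod C g"
  using comp_hom[of g "Cod C f" "Cod C g" f "Dom C f"] assms by (auto simp: hom_def)

lemma id_props:
  assumes "X \<in> Obj C"
  shows arr_id: "\<one> X \<in> Arr C" and dom_id: "Dom C (\<one> X) = X" and cod_id: "Cod C (\<one> X) = X"
  using id_hom[OF assms] by (auto simp: hom_def)

lemma id_comp: "\<lbrakk>f \<in> Arr C; Cod C f = X\<rbrakk> \<Longrightarrow> \<one> X \<cdot> f = f"
  using id_left[of f "Dom C f" X] by (simp add: hom_def)

lemma comp_id: "\<lbrakk>f \<in> Arr C; Dom C f = X\<rbrakk> \<Longrightarrow> f \<cdot> \<one> X = f"
  using id_right[of f X "Cod C f"] by (simp add: hom_def)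

lemma assoc:
  assumes "h \<in> Arr C" "g \<in> Arr C" "f \<in> Arr C" "Dom C h = Cod C g" "Dom C g = Cod C f"
  shows "(h \<cdot> g) \<cdot> f = h \<cdot> g \<cdot> f"
  using comp_assoc[of h "Cod C g" "Cod C h" g "Dom C g" f "Dom C f"] assms by (simp add: hom_def)

lemmas cat_simps = arr_comp dom_comp cod_comp arr_id dom_id cod_id id_comp comp_id
  dom_Obj cod_Obj

end

context strict_monoidal_category
begin

lemma tarr_props:
  assumes "f \<in> Arr C" "g \<in> Arr C"
  shows arr_tarr: "f \<otimes> g \<in> Arr C"
    and dom_tarr: "Dom C (f \<otimes> g) = Dom C f \<odot> Dom C g"
    and cod_tarr: "Cod C (f \<otimes> g) = Cod C f \<odot> Cod C g"
  using tarr_hom[of f "Dom C f" "Cod C f" g "Dom C g" "Cod C g"] assms by (auto simp: hom_def)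

lemma interchange:
  assumes "f' \<in> Arr C" "f \<in> Arr C" "g' \<in> Arr C" "g \<in> Arr C" "Dom C f' = Cod C f" "Dom C g' = Cod C g"
  shows "(f' \<otimes> g') \<cdot> (f \<otimes> g) = (f' \<cdot> f) \<otimes> (g' \<cdot> g)"
  using tarr_comp[of f' "Cod C f" "Cod C f'" f "Dom C f" g' "Cod C g" "Cod C g'" g "Dom C g"] assms
  by (simp add: hom_def)

text \<open>Composites are kept nested to the right, where \<open>interchange\<close> sees only the
  last two layers. This form fuses two adjacent layers that have further layers below them.\<close>

lemma interchange_comp:
  assumes "f' \<in> Arr C" "f \<in> Arr C" "g' \<in> Arr C" "g \<in> Arr C" "Dom C f' = Cod C f" "Dom C g' = Cod C g"
    "h \<in> Arr C" "Cod C h = Dom C f \<odot> Dom C g"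
  shows "(f' \<otimes> g') \<cdot> (f \<otimes> g) \<cdot> h = ((f' \<cdot> f) \<otimes> (g' \<cdot> g)) \<cdot> h"
  using assms by (simp add: interchange[symmetric] assoc cat_simps tarr_props)

lemmas mon_simps = cat_simps arr_tarr dom_tarr cod_tarr unit_Obj tobj_Obj tobj_assoc
  tobj_unit_left tobj_unit_right tarr_id tarr_unit_left tarr_unit_right

lemma id_tarr_id_tarr:
  "\<lbrakk>X \<in> Obj C; Y \<in> Obj C; f \<in> Arr C\<rbrakk> \<Longrightarrow> \<one> X \<otimes> \<one> Y \<otimes> f = \<one> (X \<odot> Y) \<otimes> f"
  by (simp add: mon_simps tarr_assoc[symmetric])

text \<open>
  Composites of tensors with matching blocks are fused into tensors of composites. Tensors are
  deliberately not rebracketed here: the bracketing decides which layers are fused.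
\<close>

lemmas merge = mon_simps interchange interchange_comp assoc

end

context strict_braided_monoidal_category
begin

section \<open>Typing, naturality and unit laws of the braiding\<close>

lemma braid_props:
  assumes "X \<in> Obj C" "Y \<in> Obj C"
  shows arr_braid: "\<c> X Y \<in> Arr C"
    and dom_braid: "Dom C (\<c> X Y) = X \<odot> Y"
    and cod_braid: "Cod C (\<c> X Y) = Y \<odot> X"
  using braid_iso[OF assms] by (auto simp: is_iso_def hom_def)

lemmas br_simps = merge arr_braid dom_braid cod_braid

text \<open>The indices of the braiding are tied to the codomains by equations, so a braiding whose
  indices are only provably equal to them still matches.\<close>

lemma natural:
  assumes "f \<in> Arr C" "g \<in> Arr C" "X = Cod C f" "Y = Cod C g"
  shows "\<c> X Y \<cdot> (f \<otimes> g) = (g \<otimes> f) \<cdot> \<c> (Dom C f) (Dom C g)"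
  using braid_natural[of f "Dom C f" X g "Dom C g" Y] assms by (simp add: hom_def)

text \<open>Cancel one factor of \<open>f \<cdot> f = f\<close> with the inverse. This yields the
  unit laws of the braiding, which are not among the axioms.\<close>

lemma idem_iso_id:
  assumes "is_iso C X X f" "f \<cdot> f = f" "X \<in> Obj C"
  shows "f = \<one> X"
proof -
  from assms(1) obtain g where g: "g \<in> hom C X X" "g \<cdot> f = \<one> X" and f: "f \<in> hom C X X"
    by (auto simp: is_iso_def)
  have "f = (g \<cdot> f) \<cdot> f" using g f by (simp add: id_left)
  also have "\<dots> = g \<cdot> f" using assms(2) comp_assoc[OF g(1) f f] by simp
  finally show ?thesis using g by simp
qed

text \<open>In the strict setting the hexagon for \<open>\<K>\<close>, \<open>\<K>\<close>,
  \<open>X\<close> says precisely that \<open>\<c> \<K> X\<close> is idempotent.\<close>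

lemma braid_unit_left: assumes X: "X \<in> Obj C" shows "\<c> \<K> X = \<one> X"
proof (rule idem_iso_id[OF _ _ X])
  show "is_iso C X X (\<c> \<K> X)"
    using braid_iso[OF unit_Obj X] X by (simp add: tobj_unit_left tobj_unit_right)
  show "\<c> \<K> X \<cdot> \<c> \<K> X = \<c> \<K> X"
    using hexagon_left[OF unit_Obj unit_Obj X] X by (simp add: br_simps)
qed

lemma braid_unit_right: assumes X: "X \<in> Obj C" shows "\<c> X \<K> = \<one> X"
proof (rule idem_iso_id[OF _ _ X])
  show "is_iso C X X (\<c> X \<K>)"
    using braid_iso[OF X unit_Obj] X by (simp add: tobj_unit_left tobj_unit_right)
  show "\<c> X \<K> \<cdot> \<c> X \<K> = \<c> X \<K>"
    using hexagon_right[OF X unit_Obj unit_Obj] X by (simp add: br_simps)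
qed

section \<open>Algebras, coalgebras and antipodes\<close>

lemma algebra_arr:
  assumes "is_algebra C A \<eta> \<mu>"
  shows "A \<in> Obj C" "\<eta> \<in> Arr C" "Dom C \<eta> = \<K>" "Cod C \<eta> = A"
    "\<mu> \<in> Arr C" "Dom C \<mu> = A \<odot> A" "Cod C \<mu> = A"
  using assms by (auto simp: is_algebra_def hom_def)

text \<open>This makes the morphisms from a coalgebra into \<open>A \<odot> B\<close> a convolution
  monoid. For associativity, naturality pushes the inner multiplications through the braidings; both
  bracketings become threefold products after a pure braid, and the two braids agree by the
  hexagons.\<close>

lemma tensor_algebra:
  assumes A: "is_algebra C A \<eta> \<mu>" and B: "is_algebra C B \<theta> \<nu>"
  shows "is_algebra C (A \<odot> B) (\<eta> \<otimes> \<theta>) ((\<mu> \<otimes> \<nu>) \<cdot> (\<one> A \<otimes> \<c> B A \<otimes> \<one> B))"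
proof -
  note s = br_simps algebra_arr[OF A] algebra_arr[OF B]
  note Aax = A[unfolded is_algebra_def] and Bax = B[unfolded is_algebra_def]
  let ?M = "(\<mu> \<otimes> \<nu>) \<cdot> (\<one> A \<otimes> \<c> B A \<otimes> \<one> B)"
  let ?c = "\<c> B A"
  have n1: "?c \<cdot> (\<theta> \<otimes> \<one> A) = \<one> A \<otimes> \<theta>"
    using natural[of \<theta> "\<one> A" B A] by (simp add: s braid_unit_left)
  have n2: "?c \<cdot> (\<one> B \<otimes> \<eta>) = \<eta> \<otimes> \<one> B"
    using natural[of "\<one> B" \<eta> B A] by (simp add: s braid_unit_right)
  have n3: "?c \<cdot> (\<nu> \<otimes> \<one> A) = (\<one> A \<otimes> \<nu>) \<cdot> \<c> (B \<odot> B) A"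
    using natural[of \<nu> "\<one> A" B A] by (simp add: s)
  have n4: "?c \<cdot> (\<one> B \<otimes> \<mu>) = (\<mu> \<otimes> \<one> B) \<cdot> \<c> B (A \<odot> A)"
    using natural[of "\<one> B" \<mu> B A] by (simp add: s)
  have unit1: "?M \<cdot> ((\<eta> \<otimes> \<theta>) \<otimes> \<one> (A \<odot> B)) = \<one> (A \<odot> B)"
  proof -
    \<comment> \<open>Rebracketed so that the middle block faces the braiding in \<open>?M\<close>;
      the unit then slides through it by \<open>n1\<close>.\<close>
    have "(\<eta> \<otimes> \<theta>) \<otimes> \<one> (A \<odot> B) = \<eta> \<otimes> (\<theta> \<otimes> \<one> A) \<otimes> \<one> B"
      by (simp add: s tarr_assoc)
    then have "?M \<cdot> ((\<eta> \<otimes> \<theta>) \<otimes> \<one> (A \<odot> B)) = (\<mu> \<otimes> \<nu>) \<cdot> (\<eta> \<otimes> (\<one> A \<otimes> \<theta>) \<otimes> \<one> B)"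
      by (simp add: s n1)
    also have "\<eta> \<otimes> (\<one> A \<otimes> \<theta>) \<otimes> \<one> B = (\<eta> \<otimes> \<one> A) \<otimes> (\<theta> \<otimes> \<one> B)"
      by (simp add: s tarr_assoc)
    finally show ?thesis using Aax Bax by (simp add: s)
  qed
  have unit2: "?M \<cdot> (\<one> (A \<odot> B) \<otimes> (\<eta> \<otimes> \<theta>)) = \<one> (A \<odot> B)"
  proof -
    have "\<one> (A \<odot> B) \<otimes> (\<eta> \<otimes> \<theta>) = \<one> A \<otimes> (\<one> B \<otimes> \<eta>) \<otimes> \<theta>"
      by (simp add: s tarr_assoc id_tarr_id_tarr)
    then have "?M \<cdot> (\<one> (A \<odot> B) \<otimes> (\<eta> \<otimes> \<theta>)) = (\<mu> \<otimes> \<nu>) \<cdot> (\<one> A \<otimes> (\<eta> \<otimes> \<one> B) \<otimes> \<theta>)"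
      by (simp add: s n2)
    also have "\<one> A \<otimes> (\<eta> \<otimes> \<one> B) \<otimes> \<theta> = (\<one> A \<otimes> \<eta>) \<otimes> (\<one> B \<otimes> \<theta>)"
      by (simp add: s tarr_assoc)
    finally show ?thesis using Aax Bax by (simp add: s)
  qed
  have left: "?M \<cdot> (?M \<otimes> \<one> (A \<odot> B)) = ((\<mu> \<cdot> (\<mu> \<otimes> \<one> A)) \<otimes> (\<nu> \<cdot> (\<nu> \<otimes> \<one> B)))
      \<cdot> (\<one> (A \<odot> A) \<otimes> \<c> (B \<odot> B) A \<otimes> \<one> B) \<cdot> (\<one> A \<otimes> ?c \<otimes> \<one> (B \<odot> A \<odot> B))"
  proof -
    have "?M \<otimes> \<one> (A \<odot> B) = (\<mu> \<otimes> (\<nu> \<otimes> \<one> A) \<otimes> \<one> B) \<cdot> (\<one> A \<otimes> ?c \<otimes> \<one> (B \<odot> A \<odot> B))"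
    proof -
      have "?M \<otimes> \<one> (A \<odot> B) = ((\<mu> \<otimes> \<nu>) \<otimes> \<one> (A \<odot> B)) \<cdot> ((\<one> A \<otimes> ?c \<otimes> \<one> B) \<otimes> \<one> (A \<odot> B))"
        by (simp add: s)
      also have "(\<one> A \<otimes> ?c \<otimes> \<one> B) \<otimes> \<one> (A \<odot> B) = \<one> A \<otimes> ?c \<otimes> \<one> (B \<odot> A \<odot> B)"
        by (simp add: s tarr_assoc)
      also have "(\<mu> \<otimes> \<nu>) \<otimes> \<one> (A \<odot> B) = \<mu> \<otimes> (\<nu> \<otimes> \<one> A) \<otimes> \<one> B"
        by (simp add: s tarr_assoc)
      finally show ?thesis .
    qed
    then have "?M \<cdot> (?M \<otimes> \<one> (A \<odot> B)) = (\<mu> \<otimes> \<nu>) \<cdot> (\<mu> \<otimes> ((\<one> A \<otimes> \<nu>) \<cdot> \<c> (B \<odot> B) A) \<otimes> \<one> B)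
         \<cdot> (\<one> A \<otimes> ?c \<otimes> \<one> (B \<odot> A \<odot> B))"
      by (simp add: s n3)
    also have "\<mu> \<otimes> ((\<one> A \<otimes> \<nu>) \<cdot> \<c> (B \<odot> B) A) \<otimes> \<one> B
        = (\<mu> \<otimes> (\<one> A \<otimes> \<nu>) \<otimes> \<one> B) \<cdot> (\<one> (A \<odot> A) \<otimes> \<c> (B \<odot> B) A \<otimes> \<one> B)"
      by (simp add: s)
    also have "\<mu> \<otimes> (\<one> A \<otimes> \<nu>) \<otimes> \<one> B = (\<mu> \<otimes> \<one> A) \<otimes> (\<nu> \<otimes> \<one> B)"
      by (simp add: s tarr_assoc)
    finally show ?thesis by (simp add: s)
  qed
  have right: "?M \<cdot> (\<one> (A \<odot> B) \<otimes> ?M) = ((\<mu> \<cdot> (\<one> A \<otimes> \<mu>)) \<otimes> (\<nu> \<cdot> (\<one> B \<otimes> \<nu>)))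
      \<cdot> (\<one> A \<otimes> \<c> B (A \<odot> A) \<otimes> \<one> (B \<odot> B)) \<cdot> (\<one> (A \<odot> B \<odot> A) \<otimes> ?c \<otimes> \<one> B)"
  proof -
    have "\<one> (A \<odot> B) \<otimes> ?M = (\<one> A \<otimes> (\<one> B \<otimes> \<mu>) \<otimes> \<nu>) \<cdot> (\<one> (A \<odot> B \<odot> A) \<otimes> ?c \<otimes> \<one> B)"
    proof -
      have "\<one> (A \<odot> B) \<otimes> ?M = (\<one> (A \<odot> B) \<otimes> \<mu> \<otimes> \<nu>) \<cdot> (\<one> (A \<odot> B) \<otimes> \<one> A \<otimes> ?c \<otimes> \<one> B)"
        by (simp add: s)
      also have "\<one> (A \<odot> B) \<otimes> \<one> A \<otimes> ?c \<otimes> \<one> B = \<one> (A \<odot> B \<odot> A) \<otimes> ?c \<otimes> \<one> B"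
        by (simp add: s id_tarr_id_tarr)
      also have "\<one> (A \<odot> B) \<otimes> \<mu> \<otimes> \<nu> = \<one> A \<otimes> (\<one> B \<otimes> \<mu>) \<otimes> \<nu>"
        by (simp add: s tarr_assoc id_tarr_id_tarr)
      finally show ?thesis .
    qed
    then have "?M \<cdot> (\<one> (A \<odot> B) \<otimes> ?M) = (\<mu> \<otimes> \<nu>) \<cdot> (\<one> A \<otimes> ((\<mu> \<otimes> \<one> B) \<cdot> \<c> B (A \<odot> A)) \<otimes> \<nu>)
         \<cdot> (\<one> (A \<odot> B \<odot> A) \<otimes> ?c \<otimes> \<one> B)"
      by (simp add: s n4)
    also have "\<one> A \<otimes> ((\<mu> \<otimes> \<one> B) \<cdot> \<c> B (A \<odot> A)) \<otimes> \<nu>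
        = (\<one> A \<otimes> (\<mu> \<otimes> \<one> B) \<otimes> \<nu>) \<cdot> (\<one> A \<otimes> \<c> B (A \<odot> A) \<otimes> \<one> (B \<odot> B))"
      by (simp add: s)
    also have "\<one> A \<otimes> (\<mu> \<otimes> \<one> B) \<otimes> \<nu> = (\<one> A \<otimes> \<mu>) \<otimes> (\<one> B \<otimes> \<nu>)"
      by (simp add: s tarr_assoc)
    finally show ?thesis by (simp add: s)
  qed
  \<comment> \<open>Write the six strands as a1 b1 a2 b2 a3 b3. Both sides carry b1 past a2 and a3
    and b2 past a3; only the order of the disjoint crossings b1/a2 and b2/a3 differs.\<close>
  have braids: "(\<one> (A \<odot> A) \<otimes> \<c> (B \<odot> B) A \<otimes> \<one> B) \<cdot> (\<one> A \<otimes> ?c \<otimes> \<one> (B \<odot> A \<odot> B))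
      = (\<one> A \<otimes> \<c> B (A \<odot> A) \<otimes> \<one> (B \<odot> B)) \<cdot> (\<one> (A \<odot> B \<odot> A) \<otimes> ?c \<otimes> \<one> B)" (is "?l = ?r")
  proof -
    have "?l = \<one> A \<otimes> ((\<one> A \<otimes> \<c> (B \<odot> B) A) \<cdot> (?c \<otimes> \<one> (B \<odot> A))) \<otimes> \<one> B"
    proof -
      have "\<one> (A \<odot> A) \<otimes> \<c> (B \<odot> B) A \<otimes> \<one> B = \<one> A \<otimes> (\<one> A \<otimes> \<c> (B \<odot> B) A) \<otimes> \<one> B"
        by (simp add: s tarr_assoc id_tarr_id_tarr)
      moreover have "\<one> A \<otimes> ?c \<otimes> \<one> (B \<odot> A \<odot> B) = \<one> A \<otimes> (?c \<otimes> \<one> (B \<odot> A)) \<otimes> \<one> B"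
        by (simp add: s tarr_assoc)
      ultimately show ?thesis by (simp add: s)
    qed
    also have "(\<one> A \<otimes> \<c> (B \<odot> B) A) \<cdot> (?c \<otimes> \<one> (B \<odot> A)) = (\<c> B (A \<odot> A) \<otimes> \<one> B) \<cdot> (\<one> (B \<odot> A) \<otimes> ?c)"
    proof -
      have "\<one> A \<otimes> \<c> (B \<odot> B) A = ((\<one> A \<otimes> ?c) \<otimes> \<one> B) \<cdot> (\<one> (A \<odot> B) \<otimes> ?c)"
      proof -
        have "(\<one> A \<otimes> ?c) \<otimes> \<one> B = \<one> A \<otimes> ?c \<otimes> \<one> B" "\<one> (A \<odot> B) \<otimes> ?c = \<one> A \<otimes> \<one> B \<otimes> ?c"
          by (simp_all add: s tarr_assoc id_tarr_id_tarr)
        then show ?thesis by (simp add: s hexagon_left)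
      qed
      then have "(\<one> A \<otimes> \<c> (B \<odot> B) A) \<cdot> (?c \<otimes> \<one> (B \<odot> A)) = ((\<one> A \<otimes> ?c) \<otimes> \<one> B) \<cdot> (?c \<otimes> ?c)"
        by (simp add: s)
      \<comment> \<open>Splitting the parallel crossings in the opposite order is what exchanges
        them.\<close>
      also have "?c \<otimes> ?c = (?c \<otimes> \<one> (A \<odot> B)) \<cdot> (\<one> (B \<odot> A) \<otimes> ?c)"
        by (simp add: s)
      also have "?c \<otimes> \<one> (A \<odot> B) = (?c \<otimes> \<one> A) \<otimes> \<one> B"
        by (simp add: s tarr_assoc)
      also have "((\<one> A \<otimes> ?c) \<otimes> \<one> B) \<cdot> ((?c \<otimes> \<one> A) \<otimes> \<one> B) \<cdot> (\<one> (B \<odot> A) \<otimes> ?c)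
          = (\<c> B (A \<odot> A) \<otimes> \<one> B) \<cdot> (\<one> (B \<odot> A) \<otimes> ?c)"
        by (simp add: s hexagon_right)
      finally show ?thesis .
    qed
    also have "\<one> A \<otimes> ((\<c> B (A \<odot> A) \<otimes> \<one> B) \<cdot> (\<one> (B \<odot> A) \<otimes> ?c)) \<otimes> \<one> B = ?r"
    proof -
      have "\<one> A \<otimes> \<c> B (A \<odot> A) \<otimes> \<one> (B \<odot> B) = \<one> A \<otimes> (\<c> B (A \<odot> A) \<otimes> \<one> B) \<otimes> \<one> B"
        by (simp add: s tarr_assoc)
      moreover have "\<one> (A \<odot> B \<odot> A) \<otimes> ?c \<otimes> \<one> B = \<one> A \<otimes> (\<one> (B \<odot> A) \<otimes> ?c) \<otimes> \<one> B"
        by (simp add: s tarr_assoc id_tarr_id_tarr)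
      ultimately show ?thesis by (simp add: s)
    qed
    finally show ?thesis .
  qed
  have "?M \<cdot> (?M \<otimes> \<one> (A \<odot> B)) = ?M \<cdot> (\<one> (A \<odot> B) \<otimes> ?M)"
    unfolding left right braids using Aax Bax by simp
  with unit1 unit2 show ?thesis
    by (simp add: is_algebra_def s homI)
qed


section \<open>Coalgebras: convolution and iterated comultiplication\<close>

lemma coalgebra_arr:
  assumes "is_coalgebra C D"
  shows "ob D \<in> Obj C" "counit D \<in> Arr C" "Dom C (counit D) = ob D" "Cod C (counit D) = \<K>"
    "comult D \<in> Arr C" "Dom C (comult D) = ob D" "Cod C (comult D) = ob D \<odot> ob D"
  using assms by (auto simp: is_coalgebra_def hom_def)

text \<open>The monoid argument \<open>f = f * (g * k) = (f * g) * k = k\<close> for the convolution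
  product, whose unit is \<open>\<eta> \<cdot> counit D\<close>.\<close>

lemma convolution_inverse_unique:
  assumes A: "is_algebra C A \<eta> \<mu>" and D: "is_coalgebra C D"
    and f: "f \<in> hom C (ob D) A" and g: "g \<in> hom C (ob D) A" and k: "k \<in> hom C (ob D) A"
    and fg: "\<mu> \<cdot> (f \<otimes> g) \<cdot> comult D = \<eta> \<cdot> counit D"
    and gk: "\<mu> \<cdot> (g \<otimes> k) \<cdot> comult D = \<eta> \<cdot> counit D"
  shows "f = k"
proof -
  note s = br_simps algebra_arr[OF A] coalgebra_arr[OF D]
  have h: "f \<in> Arr C" "Dom C f = ob D" "Cod C f = A" "g \<in> Arr C" "Dom C g = ob D" "Cod C g = A"
    "k \<in> Arr C" "Dom C k = ob D" "Cod C k = A"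
    using f g k by (auto simp: hom_def)
  let ?\<delta> = "comult D" and ?X = "ob D" and ?e = "counit D"
  \<comment> \<open>Start from \<open>f\<close> convolved with the convolution unit, using the unit
    law of \<open>A\<close> and the counit law of \<open>D\<close>.\<close>
  have "f = (\<mu> \<cdot> (\<one> A \<otimes> \<eta>)) \<cdot> f \<cdot> (\<one> ?X \<otimes> ?e) \<cdot> ?\<delta>"
    using A D by (simp add: is_algebra_def is_coalgebra_def s h)
  also have "\<dots> = \<mu> \<cdot> (((\<one> A \<otimes> \<eta>) \<cdot> f) \<cdot> (\<one> ?X \<otimes> ?e)) \<cdot> ?\<delta>"
    by (simp add: s h)
  also have "((\<one> A \<otimes> \<eta>) \<cdot> f) \<cdot> (\<one> ?X \<otimes> ?e) = f \<otimes> (\<eta> \<cdot> ?e)"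
  proof -
    \<comment> \<open>By strictness \<open>f\<close> is \<open>f \<otimes> \<one> \<K>\<close>; the
      explicit instance of \<open>interchange\<close> supplies that invisible unit factor.\<close>
    have "(\<one> A \<otimes> \<eta>) \<cdot> f = f \<otimes> \<eta>"
      using interchange[of "\<one> A" f \<eta> "\<one> \<K>"] by (simp add: s h)
    then show ?thesis by (simp only:) (simp add: s h)
  qed
  also have "\<mu> \<cdot> (f \<otimes> (\<eta> \<cdot> ?e)) \<cdot> ?\<delta> = \<mu> \<cdot> (f \<otimes> (\<mu> \<cdot> (g \<otimes> k) \<cdot> ?\<delta>)) \<cdot> ?\<delta>"
    by (simp only: gk)
  also have "\<dots> = (\<mu> \<cdot> (\<one> A \<otimes> \<mu>)) \<cdot> (f \<otimes> g \<otimes> k) \<cdot> (\<one> ?X \<otimes> ?\<delta>) \<cdot> ?\<delta>"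
    by (simp add: s h)
  also have "\<mu> \<cdot> (\<one> A \<otimes> \<mu>) = \<mu> \<cdot> (\<mu> \<otimes> \<one> A)"
    using A by (simp add: is_algebra_def)
  also have "(\<one> ?X \<otimes> ?\<delta>) \<cdot> ?\<delta> = (?\<delta> \<otimes> \<one> ?X) \<cdot> ?\<delta>"
    using D by (simp add: is_coalgebra_def)
  also have "f \<otimes> g \<otimes> k = (f \<otimes> g) \<otimes> k"
    by (simp add: h tarr_assoc)
  also have "(\<mu> \<cdot> (\<mu> \<otimes> \<one> A)) \<cdot> ((f \<otimes> g) \<otimes> k) \<cdot> (?\<delta> \<otimes> \<one> ?X) \<cdot> ?\<delta>
      = \<mu> \<cdot> ((\<mu> \<cdot> (f \<otimes> g) \<cdot> ?\<delta>) \<otimes> k) \<cdot> ?\<delta>"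
    by (simp add: s h)
  also have "\<dots> = \<mu> \<cdot> ((\<eta> \<cdot> ?e) \<otimes> k) \<cdot> ?\<delta>"
    by (simp only: fg)
  also have "(\<eta> \<cdot> ?e) \<otimes> k = ((\<eta> \<otimes> \<one> A) \<cdot> k) \<cdot> (?e \<otimes> \<one> ?X)"
  proof -
    have "(\<eta> \<otimes> \<one> A) \<cdot> k = \<eta> \<otimes> k"
      using interchange[of \<eta> "\<one> \<K>" "\<one> A" k] by (simp add: s h)
    then show ?thesis by (simp only:) (simp add: s h)
  qed
  also have "\<mu> \<cdot> (((\<eta> \<otimes> \<one> A) \<cdot> k) \<cdot> (?e \<otimes> \<one> ?X)) \<cdot> ?\<delta>
      = (\<mu> \<cdot> (\<eta> \<otimes> \<one> A)) \<cdot> k \<cdot> (?e \<otimes> \<one> ?X) \<cdot> ?\<delta>"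
    by (simp add: s h)
  also have "\<dots> = k"
    using A D by (simp add: is_algebra_def is_coalgebra_def s h)
  finally show ?thesis .
qed

text \<open>Of the four copies h1, h2, h3, h4, the right side produces the inner two by one
  comultiplication, applied last. A braiding that moves h2 and h3 together can then be treated by
  naturality.\<close>

lemma comult_quadruple:
  assumes D: "is_coalgebra C D"
  shows "(comult D \<otimes> comult D) \<cdot> comult D
      = (\<one> (ob D) \<otimes> comult D \<otimes> \<one> (ob D)) \<cdot> (\<one> (ob D) \<otimes> comult D) \<cdot> comult D"
proof -
  note s = br_simps coalgebra_arr[OF D]
  let ?\<delta> = "comult D" and ?X = "ob D"
  have ca: "(?\<delta> \<otimes> \<one> ?X) \<cdot> ?\<delta> = (\<one> ?X \<otimes> ?\<delta>) \<cdot> ?\<delta>"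
    using D by (simp add: is_coalgebra_def)
  \<comment> \<open>Letting the left comultiplication act first exposes the left side of
    coassociativity.\<close>
  have "(?\<delta> \<otimes> ?\<delta>) \<cdot> ?\<delta> = (\<one> (?X \<odot> ?X) \<otimes> ?\<delta>) \<cdot> (?\<delta> \<otimes> \<one> ?X) \<cdot> ?\<delta>"
    by (simp add: s)
  also have "\<dots> = (\<one> ?X \<otimes> \<one> ?X \<otimes> ?\<delta>) \<cdot> (\<one> ?X \<otimes> ?\<delta>) \<cdot> ?\<delta>"
    by (simp only: ca) (simp add: s id_tarr_id_tarr)
  also have "\<dots> = (\<one> ?X \<otimes> ((\<one> ?X \<otimes> ?\<delta>) \<cdot> ?\<delta>)) \<cdot> ?\<delta>"
    by (simp add: s)
  also have "(\<one> ?X \<otimes> ?\<delta>) \<cdot> ?\<delta> = (?\<delta> \<otimes> \<one> ?X) \<cdot> ?\<delta>"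
    by (rule ca[symmetric])
  also have "(\<one> ?X \<otimes> ((?\<delta> \<otimes> \<one> ?X) \<cdot> ?\<delta>)) \<cdot> ?\<delta>
      = (\<one> ?X \<otimes> ?\<delta> \<otimes> \<one> ?X) \<cdot> (\<one> ?X \<otimes> ?\<delta>) \<cdot> ?\<delta>"
    by (simp add: s)
  finally show ?thesis .
qed

section \<open>Hopf algebras: the antipode, and products with an anticomultiplicative factor\<close>

lemma hopf_algebra_arr:
  assumes X: "is_hopf_algebra C X"
  shows "ob X \<in> Obj C" "counit X \<in> Arr C" "Dom C (counit X) = ob X" "Cod C (counit X) = \<K>"
    "comult X \<in> Arr C" "Dom C (comult X) = ob X" "Cod C (comult X) = ob X \<odot> ob X"
    "unit X \<in> Arr C" "Dom C (unit X) = \<K>" "Cod C (unit X) = ob X"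
    "mult X \<in> Arr C" "Dom C (mult X) = ob X \<odot> ob X" "Cod C (mult X) = ob X"
    "antipode X \<in> Arr C" "Dom C (antipode X) = ob X" "Cod C (antipode X) = ob X"
  using X by (auto simp: is_hopf_algebra_def is_coalgebra_def is_algebra_def hom_def)

lemma hopf_algebra_eqs:
  assumes X: "is_hopf_algebra C X"
  shows hopf_comult_unit: "comult X \<cdot> unit X = unit X \<otimes> unit X"
    and hopf_counit_unit: "counit X \<cdot> unit X = \<one> \<K>"
    and hopf_comult_mult: "comult X \<cdot> mult X = (mult X \<otimes> mult X)
      \<cdot> (\<one> (ob X) \<otimes> \<c> (ob X) (ob X) \<otimes> \<one> (ob X)) \<cdot> (comult X \<otimes> comult X)"
    and hopf_counit_mult: "counit X \<cdot> mult X = counit X \<otimes> counit X"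
  using X hopf_algebra_arr[OF X]
  by (auto simp: is_hopf_algebra_def coalgebra_morphism_def unit_coalgebra_def tensor_coalgebra_def br_simps)

text \<open>Apply the counit to the antipode axiom for S(h1) h2. By multiplicativity of the counit
  the result is the counit of S(h1) times that of h2, that is, the counit of S(h).\<close>

lemma counit_antipode:
  assumes X: "is_hopf_algebra C X"
  shows "counit X \<cdot> antipode X = counit X"
proof -
  note s = br_simps hopf_algebra_arr[OF X] hopf_algebra_eqs[OF X]
  let ?e = "counit X" and ?l = "antipode X" and ?d = "comult X" and ?X = "ob X"
  have "?e \<cdot> ?l = ((?e \<cdot> ?l) \<cdot> (\<one> ?X \<otimes> ?e)) \<cdot> ?d"
    using X by (simp add: is_hopf_algebra_def is_coalgebra_def s)
  also have "(?e \<cdot> ?l) \<cdot> (\<one> ?X \<otimes> ?e) = (?e \<cdot> ?l) \<otimes> ?e"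
    using interchange[of "?e \<cdot> ?l" "\<one> ?X" "\<one> \<K>" ?e] by (simp add: s)
  also have "((?e \<cdot> ?l) \<otimes> ?e) \<cdot> ?d = (?e \<cdot> mult X) \<cdot> (?l \<otimes> \<one> ?X) \<cdot> ?d"
    unfolding hopf_algebra_eqs[OF X] by (simp add: s)
  also have "\<dots> = ?e \<cdot> unit X \<cdot> ?e"
    using X by (simp add: is_hopf_algebra_def br_simps hopf_algebra_arr[OF X])
  also have "\<dots> = (?e \<cdot> unit X) \<cdot> ?e"
    by (simp add: br_simps hopf_algebra_arr[OF X])
  also have "\<dots> = ?e"
    by (simp only: hopf_algebra_eqs[OF X] id_comp hopf_algebra_arr[OF X])
  finally show ?thesis .
qed


text \<open>The two sides are a left and a right convolution inverse of \<open>comult X\<close>. On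
  the left this is multiplicativity of the comultiplication. On the right the product is h1 S(h4) in
  the first factor and h2 S(h3) in the second: the inner pair collapses first, then the outer
  one.\<close>

lemma comult_antipode:
  assumes X: "is_hopf_algebra C X"
  shows "comult X \<cdot> antipode X
    = (antipode X \<otimes> antipode X) \<cdot> \<c> (ob X) (ob X) \<cdot> comult X"
proof -
  note s = br_simps hopf_algebra_arr[OF X]
  let ?\<epsilon> = "counit X" and ?S = "antipode X" and ?\<delta> = "comult X" and ?X = "ob X"
    and ?\<eta> = "unit X" and ?\<mu> = "mult X" and ?c = "\<c> (ob X) (ob X)"
  have A: "is_algebra C ?X ?\<eta> ?\<mu>" and D: "is_coalgebra C X"
    and al: "?\<mu> \<cdot> (?S \<otimes> \<one> ?X) \<cdot> ?\<delta> = ?\<eta> \<cdot> ?\<epsilon>"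
    and ar: "?\<mu> \<cdot> (\<one> ?X \<otimes> ?S) \<cdot> ?\<delta> = ?\<eta> \<cdot> ?\<epsilon>"
    using X unfolding is_hopf_algebra_def by blast+
  have cu: "(\<one> ?X \<otimes> ?\<epsilon>) \<cdot> ?\<delta> = \<one> ?X" "(?\<epsilon> \<otimes> \<one> ?X) \<cdot> ?\<delta> = \<one> ?X"
    using D unfolding is_coalgebra_def by blast+
  let ?M = "(?\<mu> \<otimes> ?\<mu>) \<cdot> (\<one> ?X \<otimes> ?c \<otimes> \<one> ?X)"
  have left: "?M \<cdot> ((?\<delta> \<cdot> ?S) \<otimes> ?\<delta>) \<cdot> ?\<delta> = (?\<eta> \<otimes> ?\<eta>) \<cdot> ?\<epsilon>"
  proof -
    have "?M \<cdot> ((?\<delta> \<cdot> ?S) \<otimes> ?\<delta>) \<cdot> ?\<delta>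
        = ((?\<mu> \<otimes> ?\<mu>) \<cdot> (\<one> ?X \<otimes> ?c \<otimes> \<one> ?X) \<cdot> (?\<delta> \<otimes> ?\<delta>)) \<cdot> (?S \<otimes> \<one> ?X) \<cdot> ?\<delta>"
      by (simp add: s)
    also have "\<dots> = ?\<delta> \<cdot> ?\<mu> \<cdot> (?S \<otimes> \<one> ?X) \<cdot> ?\<delta>"
      unfolding hopf_comult_mult[OF X, symmetric] by (simp add: s)
    also have "\<dots> = (?\<delta> \<cdot> ?\<eta>) \<cdot> ?\<epsilon>"
      unfolding al by (simp add: s)
    finally show ?thesis by (simp only: hopf_comult_unit[OF X])
  qed
  have right: "?M \<cdot> (?\<delta> \<otimes> ((?S \<otimes> ?S) \<cdot> ?c \<cdot> ?\<delta>)) \<cdot> ?\<delta> = (?\<eta> \<otimes> ?\<eta>) \<cdot> ?\<epsilon>"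
  proof -
    have nat1: "?c \<cdot> (\<one> ?X \<otimes> ?S) = (?S \<otimes> \<one> ?X) \<cdot> ?c"
      by (subst natural) (simp_all add: s)
    have nat2: "\<c> (?X \<odot> ?X) ?X \<cdot> (?\<delta> \<otimes> \<one> ?X) = (\<one> ?X \<otimes> ?\<delta>) \<cdot> ?c"
      by (subst natural) (simp_all add: s)
    have nat3: "(\<one> ?X \<otimes> ?\<epsilon>) \<cdot> ?c = ?\<epsilon> \<otimes> \<one> ?X"
      using natural[of ?\<epsilon> "\<one> ?X" \<K> ?X] by (simp add: s braid_unit_left)
    note nat = nat1 nat2 nat3
    \<comment> \<open>\<open>X1\<close> and \<open>X2\<close> join only the two braidings.
      Unrestricted fusion would absorb the layer of antipodes into them and hide the
      hexagon.\<close>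
    have X1: "((\<one> ?X \<otimes> (?S \<otimes> \<one> ?X) \<otimes> ?S) \<cdot> (\<one> ?X \<otimes> ?c \<otimes> \<one> ?X)) \<cdot> f
        = (\<one> ?X \<otimes> (?S \<otimes> \<one> ?X) \<otimes> ?S) \<cdot> (\<one> ?X \<otimes> ?c \<otimes> \<one> ?X) \<cdot> f"
      if "f \<in> Arr C" "Cod C f = ?X \<odot> ?X \<odot> ?X \<odot> ?X" for f
      using that by (intro assoc) (simp_all add: s)
    have X2: "(\<one> ?X \<otimes> ?c \<otimes> \<one> ?X) \<cdot> (\<one> ?X \<otimes> ((\<one> ?X \<otimes> ?c) \<cdot> (?\<delta> \<otimes> \<one> ?X) \<cdot> ?\<delta>)) \<cdot> ?\<delta>
       = (\<one> ?X \<otimes> ((?c \<otimes> \<one> ?X) \<cdot> (\<one> ?X \<otimes> ?c) \<cdot> (?\<delta> \<otimes> \<one> ?X) \<cdot> ?\<delta>)) \<cdot> ?\<delta>"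
      by (simp add: s)
    have "?M \<cdot> (?\<delta> \<otimes> ((?S \<otimes> ?S) \<cdot> ?c \<cdot> ?\<delta>)) \<cdot> ?\<delta>
        = ?M \<cdot> (\<one> (?X \<odot> ?X) \<otimes> ?S \<otimes> ?S) \<cdot> (\<one> (?X \<odot> ?X) \<otimes> ?c) \<cdot> (?\<delta> \<otimes> ?\<delta>) \<cdot> ?\<delta>"
      by (simp add: s)
    also have "(?\<delta> \<otimes> ?\<delta>) \<cdot> ?\<delta> = (\<one> ?X \<otimes> ?\<delta> \<otimes> \<one> ?X) \<cdot> (\<one> ?X \<otimes> ?\<delta>) \<cdot> ?\<delta>"
      by (rule comult_quadruple[OF D])
    also have "\<one> (?X \<odot> ?X) \<otimes> ?S \<otimes> ?S = \<one> ?X \<otimes> (\<one> ?X \<otimes> ?S) \<otimes> ?S"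
      by (simp add: s tarr_assoc id_tarr_id_tarr)
    also have "\<one> (?X \<odot> ?X) \<otimes> ?c = \<one> ?X \<otimes> \<one> ?X \<otimes> ?c"
      by (simp add: s id_tarr_id_tarr)
    also have "?M \<cdot> (\<one> ?X \<otimes> (\<one> ?X \<otimes> ?S) \<otimes> ?S) \<cdot> (\<one> ?X \<otimes> \<one> ?X \<otimes> ?c)
          \<cdot> (\<one> ?X \<otimes> ?\<delta> \<otimes> \<one> ?X) \<cdot> (\<one> ?X \<otimes> ?\<delta>) \<cdot> ?\<delta>
        = (?\<mu> \<otimes> ?\<mu>) \<cdot> (\<one> ?X \<otimes> (?c \<cdot> (\<one> ?X \<otimes> ?S)) \<otimes> ?S)
          \<cdot> (\<one> ?X \<otimes> ((\<one> ?X \<otimes> ?c) \<cdot> (?\<delta> \<otimes> \<one> ?X) \<cdot> ?\<delta>)) \<cdot> ?\<delta>"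
      by (simp add: s)
    also have "\<one> ?X \<otimes> (?c \<cdot> (\<one> ?X \<otimes> ?S)) \<otimes> ?S
        = (\<one> ?X \<otimes> (?S \<otimes> \<one> ?X) \<otimes> ?S) \<cdot> (\<one> ?X \<otimes> ?c \<otimes> \<one> ?X)"
      unfolding nat(1) by (simp add: s)
    also have "(?\<mu> \<otimes> ?\<mu>) \<cdot> ((\<one> ?X \<otimes> (?S \<otimes> \<one> ?X) \<otimes> ?S) \<cdot> (\<one> ?X \<otimes> ?c \<otimes> \<one> ?X))
          \<cdot> (\<one> ?X \<otimes> ((\<one> ?X \<otimes> ?c) \<cdot> (?\<delta> \<otimes> \<one> ?X) \<cdot> ?\<delta>)) \<cdot> ?\<delta>
        = (?\<mu> \<otimes> ?\<mu>) \<cdot> (\<one> ?X \<otimes> (?S \<otimes> \<one> ?X) \<otimes> ?S)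
          \<cdot> (\<one> ?X \<otimes> ((?c \<otimes> \<one> ?X) \<cdot> (\<one> ?X \<otimes> ?c) \<cdot> (?\<delta> \<otimes> \<one> ?X) \<cdot> ?\<delta>)) \<cdot> ?\<delta>"
      by (subst X1) (simp_all add: X2 s del: interchange interchange_comp)
    \<comment> \<open>The two crossings carry h4 past h3 and h2; as a single crossing they commute
      with the comultiplication that creates h2 and h3.\<close>
    also have "(?c \<otimes> \<one> ?X) \<cdot> (\<one> ?X \<otimes> ?c) \<cdot> (?\<delta> \<otimes> \<one> ?X) \<cdot> ?\<delta>
        = (\<c> (?X \<odot> ?X) ?X \<cdot> (?\<delta> \<otimes> \<one> ?X)) \<cdot> ?\<delta>"
      by (simp add: s hexagon_left)
    also have "\<dots> = (\<one> ?X \<otimes> ?\<delta>) \<cdot> ?c \<cdot> ?\<delta>"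
      unfolding nat by (simp add: s)
    also have "\<one> ?X \<otimes> (?S \<otimes> \<one> ?X) \<otimes> ?S = (\<one> ?X \<otimes> ?S) \<otimes> (\<one> ?X \<otimes> ?S)"
      by (simp add: s tarr_assoc)
    also have "(?\<mu> \<otimes> ?\<mu>) \<cdot> ((\<one> ?X \<otimes> ?S) \<otimes> (\<one> ?X \<otimes> ?S))
          \<cdot> (\<one> ?X \<otimes> ((\<one> ?X \<otimes> ?\<delta>) \<cdot> ?c \<cdot> ?\<delta>)) \<cdot> ?\<delta>
        = ((?\<mu> \<cdot> (\<one> ?X \<otimes> ?S)) \<otimes> (?\<mu> \<cdot> (\<one> ?X \<otimes> ?S)))
          \<cdot> (\<one> ?X \<otimes> \<one> ?X \<otimes> ?\<delta>) \<cdot> (\<one> ?X \<otimes> (?c \<cdot> ?\<delta>)) \<cdot> ?\<delta>"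
      by (simp add: s)
    also have "\<one> ?X \<otimes> \<one> ?X \<otimes> ?\<delta> = \<one> (?X \<odot> ?X) \<otimes> ?\<delta>"
      by (simp add: s id_tarr_id_tarr)
    also have "((?\<mu> \<cdot> (\<one> ?X \<otimes> ?S)) \<otimes> (?\<mu> \<cdot> (\<one> ?X \<otimes> ?S)))
          \<cdot> (\<one> (?X \<odot> ?X) \<otimes> ?\<delta>) \<cdot> (\<one> ?X \<otimes> (?c \<cdot> ?\<delta>)) \<cdot> ?\<delta>
        = ((?\<mu> \<cdot> (\<one> ?X \<otimes> ?S)) \<otimes> (?\<mu> \<cdot> (\<one> ?X \<otimes> ?S) \<cdot> ?\<delta>)) \<cdot> (\<one> ?X \<otimes> (?c \<cdot> ?\<delta>)) \<cdot> ?\<delta>"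
      by (simp add: s)
    \<comment> \<open>The inner pair h2 S(h3) has become unit after counit; the counit is next
      pulled back through the braiding by \<open>nat3\<close> and absorbed by the counit
      law.\<close>
    also have "\<dots> = ((?\<mu> \<cdot> (\<one> ?X \<otimes> ?S)) \<otimes> ?\<eta>)
          \<cdot> (\<one> (?X \<odot> ?X) \<otimes> ?\<epsilon>) \<cdot> (\<one> ?X \<otimes> (?c \<cdot> ?\<delta>)) \<cdot> ?\<delta>"
      unfolding ar by (simp add: s)
    also have "\<one> (?X \<odot> ?X) \<otimes> ?\<epsilon> = \<one> ?X \<otimes> \<one> ?X \<otimes> ?\<epsilon>"
      by (simp add: s id_tarr_id_tarr)
    also have "(\<one> ?X \<otimes> \<one> ?X \<otimes> ?\<epsilon>) \<cdot> (\<one> ?X \<otimes> (?c \<cdot> ?\<delta>)) \<cdot> ?\<delta>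
        = (\<one> ?X \<otimes> (((\<one> ?X \<otimes> ?\<epsilon>) \<cdot> ?c) \<cdot> ?\<delta>)) \<cdot> ?\<delta>"
      by (simp add: s)
    also have "\<dots> = ?\<delta>"
      unfolding nat cu by (simp add: s)
    also have "((?\<mu> \<cdot> (\<one> ?X \<otimes> ?S)) \<otimes> ?\<eta>) \<cdot> ?\<delta> = (\<one> ?X \<otimes> ?\<eta>) \<cdot> ?\<mu> \<cdot> (\<one> ?X \<otimes> ?S) \<cdot> ?\<delta>"
    proof -
      have "(?\<mu> \<cdot> (\<one> ?X \<otimes> ?S)) \<otimes> ?\<eta> = (\<one> ?X \<otimes> ?\<eta>) \<cdot> ?\<mu> \<cdot> (\<one> ?X \<otimes> ?S)"
        using interchange[of "\<one> ?X" "?\<mu> \<cdot> (\<one> ?X \<otimes> ?S)" ?\<eta> "\<one> \<K>"] by (simp add: s)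
      then show ?thesis by (simp only:) (simp add: s)
    qed
    also have "\<dots> = ((\<one> ?X \<otimes> ?\<eta>) \<cdot> ?\<eta>) \<cdot> ?\<epsilon>"
      unfolding ar by (simp add: s)
    also have "(\<one> ?X \<otimes> ?\<eta>) \<cdot> ?\<eta> = ?\<eta> \<otimes> ?\<eta>"
      using interchange[of "\<one> ?X" ?\<eta> ?\<eta> "\<one> \<K>"] by (simp add: s)
    finally show ?thesis .
  qed
  show ?thesis
  \<comment> \<open>The comultiplication itself is the element being inverted, with values in the
    tensor square of the algebra \<open>X\<close>.\<close>
  proof (rule convolution_inverse_unique[OF tensor_algebra[OF A A] D, where g = ?\<delta>])
    show "?M \<cdot> ((?\<delta> \<cdot> ?S) \<otimes> ?\<delta>) \<cdot> ?\<delta> = (?\<eta> \<otimes> ?\<eta>) \<cdot> ?\<epsilon>"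
      by (rule left)
    show "?M \<cdot> (?\<delta> \<otimes> ((?S \<otimes> ?S) \<cdot> ?c \<cdot> ?\<delta>)) \<cdot> ?\<delta> = (?\<eta> \<otimes> ?\<eta>) \<cdot> ?\<epsilon>"
      by (rule right)
  qed (simp_all add: s homI)
qed


text \<open>Both sides send h to h2, h3, h1, h4. The strand of h1 crosses h2 and then h3; by the
  hexagon this is one crossing with their tensor product, and naturality pulls the comultiplication
  producing h2 and h3 over it.\<close>

lemma comult_anticomult:
  assumes D: "is_coalgebra C D"
  shows "(\<one> (ob D) \<otimes> \<c> (ob D) (ob D) \<otimes> \<one> (ob D))
      \<cdot> ((\<c> (ob D) (ob D) \<cdot> comult D) \<otimes> comult D) \<cdot> comult D
    = (comult D \<otimes> \<one> (ob D \<odot> ob D)) \<cdot> ((\<c> (ob D) (ob D) \<cdot> comult D) \<otimes> \<one> (ob D)) \<cdot> comult D"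
proof -
  note s = br_simps coalgebra_arr[OF D]
  let ?\<delta> = "comult D" and ?X = "ob D"
  let ?c = "\<c> ?X ?X"
  have ca: "(?\<delta> \<otimes> \<one> ?X) \<cdot> ?\<delta> = (\<one> ?X \<otimes> ?\<delta>) \<cdot> ?\<delta>"
    using D unfolding is_coalgebra_def by blast
  have nat: "\<c> ?X (?X \<odot> ?X) \<cdot> (\<one> ?X \<otimes> ?\<delta>) = (?\<delta> \<otimes> \<one> ?X) \<cdot> ?c"
    by (subst natural) (simp_all add: s)
  have "((?c \<cdot> ?\<delta>) \<otimes> ?\<delta>) \<cdot> ?\<delta> = (?c \<otimes> \<one> (?X \<odot> ?X)) \<cdot> (?\<delta> \<otimes> ?\<delta>) \<cdot> ?\<delta>"
    by (simp add: s)
  also have "(?\<delta> \<otimes> ?\<delta>) \<cdot> ?\<delta> = (\<one> ?X \<otimes> ?\<delta> \<otimes> \<one> ?X) \<cdot> (\<one> ?X \<otimes> ?\<delta>) \<cdot> ?\<delta>"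
    by (rule comult_quadruple[OF D])
  also have "(\<one> ?X \<otimes> ?\<delta>) \<cdot> ?\<delta> = (?\<delta> \<otimes> \<one> ?X) \<cdot> ?\<delta>"
    by (rule ca[symmetric])
  also have "\<one> ?X \<otimes> ?\<delta> \<otimes> \<one> ?X = (\<one> ?X \<otimes> ?\<delta>) \<otimes> \<one> ?X"
    by (simp add: s tarr_assoc)
  also have "?c \<otimes> \<one> (?X \<odot> ?X) = (?c \<otimes> \<one> ?X) \<otimes> \<one> ?X"
    by (simp add: s tarr_assoc)
  finally have "(\<one> ?X \<otimes> ?c \<otimes> \<one> ?X) \<cdot> ((?c \<cdot> ?\<delta>) \<otimes> ?\<delta>) \<cdot> ?\<delta> = ((\<one> ?X \<otimes> ?c) \<otimes> \<one> ?X)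
      \<cdot> ((?c \<otimes> \<one> ?X) \<otimes> \<one> ?X) \<cdot> ((\<one> ?X \<otimes> ?\<delta>) \<otimes> \<one> ?X) \<cdot> (?\<delta> \<otimes> \<one> ?X) \<cdot> ?\<delta>"
    by (simp only: tarr_assoc s)
  also have "\<dots> = (((\<c> ?X (?X \<odot> ?X) \<cdot> (\<one> ?X \<otimes> ?\<delta>)) \<cdot> ?\<delta>) \<otimes> \<one> ?X) \<cdot> ?\<delta>"
    by (simp add: s hexagon_right)
  also have "\<dots> = ((?\<delta> \<otimes> \<one> ?X) \<otimes> \<one> ?X) \<cdot> ((?c \<cdot> ?\<delta>) \<otimes> \<one> ?X) \<cdot> ?\<delta>"
    unfolding nat by (simp add: s)
  also have "(?\<delta> \<otimes> \<one> ?X) \<otimes> \<one> ?X = ?\<delta> \<otimes> \<one> (?X \<odot> ?X)"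
    by (simp add: s tarr_assoc)
  finally show ?thesis .
qed

text \<open>The core computation, with the composite of antipode and \<open>u\<close> abstracted to
  a morphism \<open>\<sigma>\<close> that preserves the counit and reverses the comultiplication,
  and with an arbitrary coalgebra \<open>E\<close> as the second tensor factor of the
  source.\<close>

lemma anticomult_product_coalgebra_morphism:
  assumes D: "is_coalgebra C D" and E: "is_coalgebra C E" and B: "is_hopf_algebra C B"
    and sh: "\<sigma> \<in> hom C (ob D) (ob B)"
    and s\<epsilon>: "counit B \<cdot> \<sigma> = counit D"
    and s\<delta>: "comult B \<cdot> \<sigma> = (\<sigma> \<otimes> \<sigma>) \<cdot> \<c> (ob D) (ob D) \<cdot> comult D"
    and f: "coalgebra_morphism C (tensor_coalgebra C D E) B \<phi>"
    and P: "\<Phi> = mult B \<cdot> (\<sigma> \<otimes> \<phi>) \<cdot> (comult D \<otimes> \<one> (ob E))"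
    and cocomm: "(\<Phi> \<otimes> \<one> (ob D)) \<cdot> (\<one> (ob D) \<otimes> \<c> (ob D) (ob E))
        \<cdot> ((\<c> (ob D) (ob D) \<cdot> comult D) \<otimes> \<one> (ob E))
      = (\<Phi> \<otimes> \<one> (ob D)) \<cdot> (\<one> (ob D) \<otimes> \<c> (ob D) (ob E)) \<cdot> (comult D \<otimes> \<one> (ob E))"
  shows "coalgebra_morphism C (tensor_coalgebra C D E) B \<Phi>"
proof -
  let ?X = "ob D" and ?Z = "ob E" and ?Y = "ob B" and ?\<delta> = "comult D" and ?d = "comult E"
    and ?\<mu> = "mult B"
  let ?c = "\<c> ?X ?Z" and ?b = "\<c> ?X ?X" and ?P = "?\<mu> \<cdot> (\<sigma> \<otimes> \<phi>)"
  have h: "\<sigma> \<in> Arr C" "Dom C \<sigma> = ?X" "Cod C \<sigma> = ?Y"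
    "\<phi> \<in> Arr C" "Dom C \<phi> = ?X \<odot> ?Z" "Cod C \<phi> = ?Y"
    using sh f by (auto simp: hom_def coalgebra_morphism_def tensor_coalgebra_def)
  note s = br_simps coalgebra_arr[OF D] coalgebra_arr[OF E] hopf_algebra_arr[OF B] h
  have PX: "\<Phi> \<in> Arr C" "Dom C \<Phi> = ?X \<odot> ?Z" "Cod C \<Phi> = ?Y"
    by (simp_all add: P s)
  have f\<epsilon>: "counit B \<cdot> \<phi> = counit D \<otimes> counit E"
    and f\<delta>: "comult B \<cdot> \<phi> = (\<phi> \<otimes> \<phi>) \<cdot> (\<one> ?X \<otimes> ?c \<otimes> \<one> ?Z) \<cdot> (?\<delta> \<otimes> ?d)"
    using f by (simp_all add: coalgebra_morphism_def tensor_coalgebra_def)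
  have ca: "(?\<delta> \<otimes> \<one> ?X) \<cdot> ?\<delta> = (\<one> ?X \<otimes> ?\<delta>) \<cdot> ?\<delta>" and cu: "(counit D \<otimes> \<one> ?X) \<cdot> ?\<delta> = \<one> ?X"
    using D unfolding is_coalgebra_def by blast+
  have counit: "counit B \<cdot> \<Phi> = counit D \<otimes> counit E"
  proof -
    have "counit B \<cdot> \<Phi> = (counit B \<cdot> ?\<mu>) \<cdot> (\<sigma> \<otimes> \<phi>) \<cdot> (?\<delta> \<otimes> \<one> ?Z)"
      by (simp add: P s)
    also have "\<dots> = ((counit B \<cdot> \<sigma>) \<otimes> (counit B \<cdot> \<phi>)) \<cdot> (?\<delta> \<otimes> \<one> ?Z)"
      unfolding hopf_counit_mult[OF B] by (simp add: s)
    also have "\<dots> = ((counit D \<otimes> counit D) \<otimes> counit E) \<cdot> (?\<delta> \<otimes> \<one> ?Z)"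
      unfolding s\<epsilon> f\<epsilon> by (simp add: s tarr_assoc)
    also have "counit D \<otimes> counit D = counit D \<cdot> (counit D \<otimes> \<one> ?X)"
      using interchange[of "\<one> \<K>" "counit D" "counit D" "\<one> ?X"] by (simp add: s)
    also have "((counit D \<cdot> (counit D \<otimes> \<one> ?X)) \<otimes> counit E) \<cdot> (?\<delta> \<otimes> \<one> ?Z)
        = (counit D \<cdot> (counit D \<otimes> \<one> ?X) \<cdot> ?\<delta>) \<otimes> counit E"
      by (simp add: s)
    finally show ?thesis unfolding cu by (simp add: s)
  qed
  \<comment> \<open>\<open>?P\<close> is \<open>\<Phi>\<close> before its comultiplication: it takes
    two separate legs in \<open>?X\<close>. Multiplicativity of \<open>comult B\<close> and
    naturality gather all copies of \<open>\<sigma>\<close> and \<open>\<phi>\<close> on the outside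
    and leave a braid of the inputs.\<close>
  have comult_P: "comult B \<cdot> ?P = (?P \<otimes> ?P) \<cdot> (\<one> ?X \<otimes> \<c> ?X (?X \<odot> ?Z) \<otimes> \<one> (?X \<odot> ?Z))
      \<cdot> ((?b \<cdot> ?\<delta>) \<otimes> ((\<one> ?X \<otimes> ?c \<otimes> \<one> ?Z) \<cdot> (?\<delta> \<otimes> ?d)))"
  proof -
    have nat: "\<c> ?Y ?Y \<cdot> (\<sigma> \<otimes> \<phi>) = (\<phi> \<otimes> \<sigma>) \<cdot> \<c> ?X (?X \<odot> ?Z)"
      by (subst natural) (simp_all add: s)
    have "comult B \<cdot> ?P = (comult B \<cdot> ?\<mu>) \<cdot> (\<sigma> \<otimes> \<phi>)"
      by (simp add: s)
    also have "\<dots> = (?\<mu> \<otimes> ?\<mu>) \<cdot> (\<one> ?Y \<otimes> \<c> ?Y ?Y \<otimes> \<one> ?Y)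
        \<cdot> ((comult B \<cdot> \<sigma>) \<otimes> (comult B \<cdot> \<phi>))"
      unfolding hopf_comult_mult[OF B] by (simp add: s)
    also have "(comult B \<cdot> \<sigma>) \<otimes> (comult B \<cdot> \<phi>) = ((\<sigma> \<otimes> \<sigma>) \<otimes> (\<phi> \<otimes> \<phi>))
        \<cdot> ((?b \<cdot> ?\<delta>) \<otimes> ((\<one> ?X \<otimes> ?c \<otimes> \<one> ?Z) \<cdot> (?\<delta> \<otimes> ?d)))" (is "_ = _ \<cdot> ?R")
      unfolding s\<delta> f\<delta> by (simp add: s)
    also have "(\<sigma> \<otimes> \<sigma>) \<otimes> (\<phi> \<otimes> \<phi>) = \<sigma> \<otimes> (\<sigma> \<otimes> \<phi>) \<otimes> \<phi>"
      by (simp add: s tarr_assoc)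
    also have "(?\<mu> \<otimes> ?\<mu>) \<cdot> (\<one> ?Y \<otimes> \<c> ?Y ?Y \<otimes> \<one> ?Y) \<cdot> (\<sigma> \<otimes> (\<sigma> \<otimes> \<phi>) \<otimes> \<phi>) \<cdot> ?R
        = (?\<mu> \<otimes> ?\<mu>) \<cdot> (\<sigma> \<otimes> (\<c> ?Y ?Y \<cdot> (\<sigma> \<otimes> \<phi>)) \<otimes> \<phi>) \<cdot> ?R"
      by (simp add: s)
    also have "\<sigma> \<otimes> (\<c> ?Y ?Y \<cdot> (\<sigma> \<otimes> \<phi>)) \<otimes> \<phi>
        = (\<sigma> \<otimes> (\<phi> \<otimes> \<sigma>) \<otimes> \<phi>) \<cdot> (\<one> ?X \<otimes> \<c> ?X (?X \<odot> ?Z) \<otimes> \<one> (?X \<odot> ?Z))"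
      unfolding nat by (simp add: s)
    also have "\<sigma> \<otimes> (\<phi> \<otimes> \<sigma>) \<otimes> \<phi> = (\<sigma> \<otimes> \<phi>) \<otimes> (\<sigma> \<otimes> \<phi>)"
      by (simp add: s tarr_assoc)
    finally show ?thesis by (simp add: s)
  qed
  \<comment> \<open>Both sides produce the legs h2, h3, b1, h1, h4, b2. On the right, h2 and h3 come
    from an outermost comultiplication, as needed to turn the first \<open>?P\<close> into
    \<open>\<Phi>\<close>.\<close>
  have rearrange: "(\<one> ?X \<otimes> \<c> ?X (?X \<odot> ?Z) \<otimes> \<one> (?X \<odot> ?Z))
      \<cdot> ((?b \<cdot> ?\<delta>) \<otimes> ((\<one> ?X \<otimes> ?c \<otimes> \<one> ?Z) \<cdot> (?\<delta> \<otimes> ?d))) \<cdot> (?\<delta> \<otimes> \<one> ?Z)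
    = (?\<delta> \<otimes> \<one> (?Z \<odot> ?X \<odot> ?X \<odot> ?Z)) \<cdot> (\<one> ?X \<otimes> ?c \<otimes> \<one> (?X \<odot> ?Z))
      \<cdot> ((?b \<cdot> ?\<delta>) \<otimes> \<one> (?Z \<odot> ?X \<odot> ?Z)) \<cdot> (\<one> ?X \<otimes> ?c \<otimes> \<one> ?Z) \<cdot> (?\<delta> \<otimes> ?d)" (is "?l = ?r")
  proof -
    let ?X2 = "?X \<odot> ?X" and ?X3 = "?X \<odot> ?X \<odot> ?X"
    let ?L = "((?b \<cdot> ?\<delta>) \<otimes> ?\<delta>) \<cdot> ?\<delta>"
    \<comment> \<open>Separates the crossing of h4 with b1 from the comultiplications;
      \<open>?L\<close> yields h2, h1, h3, h4.\<close>
    have e1: "((?b \<cdot> ?\<delta>) \<otimes> ((\<one> ?X \<otimes> ?c \<otimes> \<one> ?Z) \<cdot> (?\<delta> \<otimes> ?d))) \<cdot> (?\<delta> \<otimes> \<one> ?Z)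
        = (\<one> ?X3 \<otimes> (?c \<otimes> \<one> ?Z)) \<cdot> (?L \<otimes> ?d)"
    proof -
      have "(?b \<cdot> ?\<delta>) \<otimes> ((\<one> ?X \<otimes> ?c \<otimes> \<one> ?Z) \<cdot> (?\<delta> \<otimes> ?d))
          = (\<one> ?X2 \<otimes> \<one> ?X \<otimes> ?c \<otimes> \<one> ?Z) \<cdot> ((?b \<cdot> ?\<delta>) \<otimes> (?\<delta> \<otimes> ?d))"
        by (simp add: s)
      also have "(?b \<cdot> ?\<delta>) \<otimes> (?\<delta> \<otimes> ?d) = ((?b \<cdot> ?\<delta>) \<otimes> ?\<delta>) \<otimes> ?d"
        by (simp add: s tarr_assoc)
      also have "\<one> ?X2 \<otimes> \<one> ?X \<otimes> ?c \<otimes> \<one> ?Z = \<one> ?X3 \<otimes> (?c \<otimes> \<one> ?Z)"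
        by (simp add: s id_tarr_id_tarr)
      finally have "((?b \<cdot> ?\<delta>) \<otimes> ((\<one> ?X \<otimes> ?c \<otimes> \<one> ?Z) \<cdot> (?\<delta> \<otimes> ?d))) \<cdot> (?\<delta> \<otimes> \<one> ?Z)
          = ((\<one> ?X3 \<otimes> (?c \<otimes> \<one> ?Z)) \<cdot> (((?b \<cdot> ?\<delta>) \<otimes> ?\<delta>) \<otimes> ?d)) \<cdot> (?\<delta> \<otimes> \<one> ?Z)"
        by (rule arg_cong)
      also have "\<dots> = (\<one> ?X3 \<otimes> (?c \<otimes> \<one> ?Z)) \<cdot> (((?b \<cdot> ?\<delta>) \<otimes> ?\<delta>) \<otimes> ?d) \<cdot> (?\<delta> \<otimes> \<one> ?Z)"
        by (rule assoc) (simp_all add: s)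
      also have "(((?b \<cdot> ?\<delta>) \<otimes> ?\<delta>) \<otimes> ?d) \<cdot> (?\<delta> \<otimes> \<one> ?Z) = ?L \<otimes> ?d"
        by (simp add: s)
      finally show ?thesis .
    qed
    \<comment> \<open>By the hexagon, h1 crosses h3 first and then b1.\<close>
    have e2: "\<one> ?X \<otimes> \<c> ?X (?X \<odot> ?Z) \<otimes> \<one> (?X \<odot> ?Z)
        = (\<one> ?X2 \<otimes> ?c \<otimes> \<one> (?X \<odot> ?Z)) \<cdot> ((\<one> ?X \<otimes> ?b) \<otimes> \<one> (?Z \<odot> ?X \<odot> ?Z))"
    proof -
      have "\<one> ?X \<otimes> \<c> ?X (?X \<odot> ?Z) \<otimes> \<one> (?X \<odot> ?Z)
          = (\<one> ?X \<otimes> (\<one> ?X \<otimes> ?c) \<otimes> \<one> (?X \<odot> ?Z)) \<cdot> (\<one> ?X \<otimes> (?b \<otimes> \<one> ?Z) \<otimes> \<one> (?X \<odot> ?Z))"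
        by (simp add: s hexagon_right)
      also have "\<one> ?X \<otimes> (\<one> ?X \<otimes> ?c) \<otimes> \<one> (?X \<odot> ?Z) = \<one> ?X2 \<otimes> ?c \<otimes> \<one> (?X \<odot> ?Z)"
        by (simp add: s tarr_assoc id_tarr_id_tarr)
      also have "\<one> ?X \<otimes> (?b \<otimes> \<one> ?Z) \<otimes> \<one> (?X \<odot> ?Z) = (\<one> ?X \<otimes> ?b) \<otimes> \<one> (?Z \<odot> ?X \<odot> ?Z)"
        by (simp add: s tarr_assoc)
      finally show ?thesis .
    qed
    \<comment> \<open>The crossings h1/h3 and h4/b1 use disjoint strands and commute. This brings
      the former onto \<open>?L\<close>, where \<open>comult_anticomult\<close> applies.\<close>
    have e3: "((\<one> ?X \<otimes> ?b) \<otimes> \<one> (?Z \<odot> ?X \<odot> ?Z)) \<cdot> (\<one> ?X3 \<otimes> (?c \<otimes> \<one> ?Z)) \<cdot> (?L \<otimes> ?d)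
        = (\<one> ?X3 \<otimes> (?c \<otimes> \<one> ?Z)) \<cdot> (((\<one> ?X \<otimes> ?b \<otimes> \<one> ?X) \<cdot> ?L) \<otimes> ?d)"
    proof -
      have "((\<one> ?X \<otimes> ?b) \<otimes> \<one> (?Z \<odot> ?X \<odot> ?Z)) \<cdot> (\<one> ?X3 \<otimes> (?c \<otimes> \<one> ?Z))
          = (\<one> ?X \<otimes> ?b) \<otimes> (?c \<otimes> \<one> ?Z)"
        by (simp add: s)
      also have "\<dots> = (\<one> ?X3 \<otimes> (?c \<otimes> \<one> ?Z)) \<cdot> ((\<one> ?X \<otimes> ?b) \<otimes> \<one> (?X \<odot> ?Z \<odot> ?Z))"
        by (simp add: s)
      also have "(\<one> ?X \<otimes> ?b) \<otimes> \<one> (?X \<odot> ?Z \<odot> ?Z) = (\<one> ?X \<otimes> ?b \<otimes> \<one> ?X) \<otimes> \<one> (?Z \<odot> ?Z)"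
        by (simp add: s tarr_assoc)
      finally have "(((\<one> ?X \<otimes> ?b) \<otimes> \<one> (?Z \<odot> ?X \<odot> ?Z)) \<cdot> (\<one> ?X3 \<otimes> (?c \<otimes> \<one> ?Z))) \<cdot> (?L \<otimes> ?d)
          = ((\<one> ?X3 \<otimes> (?c \<otimes> \<one> ?Z)) \<cdot> ((\<one> ?X \<otimes> ?b \<otimes> \<one> ?X) \<otimes> \<one> (?Z \<odot> ?Z))) \<cdot> (?L \<otimes> ?d)"
        by (rule arg_cong)
      also have "\<dots> = (\<one> ?X3 \<otimes> (?c \<otimes> \<one> ?Z)) \<cdot> ((\<one> ?X \<otimes> ?b \<otimes> \<one> ?X) \<otimes> \<one> (?Z \<odot> ?Z)) \<cdot> (?L \<otimes> ?d)"
        by (rule assoc) (simp_all add: s)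
      also have "((\<one> ?X \<otimes> ?b \<otimes> \<one> ?X) \<otimes> \<one> (?Z \<odot> ?Z)) \<cdot> (?L \<otimes> ?d)
          = ((\<one> ?X \<otimes> ?b \<otimes> \<one> ?X) \<cdot> ?L) \<otimes> ?d"
        by (simp add: s)
      finally show ?thesis by (simp add: s)
    qed
    let ?N = "((?b \<cdot> ?\<delta>) \<otimes> \<one> ?X) \<cdot> ?\<delta>"
    \<comment> \<open>From here the legs from \<open>?N\<close> are h2, h1, h3, with h2 still to be
      comultiplied. Steps \<open>e4\<close> and \<open>e5\<close> pull that comultiplication past
      both crossings with b1, and \<open>e6\<close> moves the last crossing below the reversed
      comultiplication.\<close>
    have e4: "(\<one> ?X3 \<otimes> (?c \<otimes> \<one> ?Z)) \<cdot> (((?\<delta> \<otimes> \<one> ?X2) \<cdot> ?N) \<otimes> ?d)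
        = (?\<delta> \<otimes> \<one> ?X \<otimes> ?c \<otimes> \<one> ?Z) \<cdot> (?N \<otimes> ?d)"
    proof -
      have "((?\<delta> \<otimes> \<one> ?X2) \<cdot> ?N) \<otimes> ?d = ((?\<delta> \<otimes> \<one> ?X2) \<otimes> \<one> (?Z \<odot> ?Z)) \<cdot> (?N \<otimes> ?d)"
        by (simp add: s)
      also have "(?\<delta> \<otimes> \<one> ?X2) \<otimes> \<one> (?Z \<odot> ?Z) = ?\<delta> \<otimes> \<one> (?X \<odot> ?X \<odot> ?Z \<odot> ?Z)"
        by (simp add: s tarr_assoc)
      finally have "(\<one> ?X3 \<otimes> (?c \<otimes> \<one> ?Z)) \<cdot> (((?\<delta> \<otimes> \<one> ?X2) \<cdot> ?N) \<otimes> ?d)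
          = (\<one> ?X3 \<otimes> (?c \<otimes> \<one> ?Z)) \<cdot> (?\<delta> \<otimes> \<one> (?X \<odot> ?X \<odot> ?Z \<odot> ?Z)) \<cdot> (?N \<otimes> ?d)"
        by (rule arg_cong)
      also have r: "\<one> ?X3 \<otimes> (?c \<otimes> \<one> ?Z) = \<one> ?X2 \<otimes> \<one> ?X \<otimes> ?c \<otimes> \<one> ?Z"
        by (simp add: s id_tarr_id_tarr)
      also have "(\<one> ?X2 \<otimes> \<one> ?X \<otimes> ?c \<otimes> \<one> ?Z) \<cdot> (?\<delta> \<otimes> \<one> (?X \<odot> ?X \<odot> ?Z \<odot> ?Z)) \<cdot> (?N \<otimes> ?d)
          = (?\<delta> \<otimes> \<one> ?X \<otimes> ?c \<otimes> \<one> ?Z) \<cdot> (?N \<otimes> ?d)"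
        by (simp add: s)
      finally show ?thesis by (simp only: r)
    qed
    have e5: "(\<one> ?X2 \<otimes> ?c \<otimes> \<one> (?X \<odot> ?Z)) \<cdot> (?\<delta> \<otimes> \<one> ?X \<otimes> ?c \<otimes> \<one> ?Z) \<cdot> (?N \<otimes> ?d)
        = (?\<delta> \<otimes> \<one> (?Z \<odot> ?X \<odot> ?X \<odot> ?Z)) \<cdot> (\<one> ?X \<otimes> ?c \<otimes> \<one> (?X \<odot> ?Z))
          \<cdot> (\<one> ?X \<otimes> \<one> ?X \<otimes> ?c \<otimes> \<one> ?Z) \<cdot> (?N \<otimes> ?d)"
      by (simp add: s)
    have e6: "(\<one> ?X \<otimes> \<one> ?X \<otimes> ?c \<otimes> \<one> ?Z) \<cdot> (?N \<otimes> ?d)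
        = ((?b \<cdot> ?\<delta>) \<otimes> \<one> (?Z \<odot> ?X \<odot> ?Z)) \<cdot> (\<one> ?X \<otimes> ?c \<otimes> \<one> ?Z) \<cdot> (?\<delta> \<otimes> ?d)"
    proof -
      have "?N \<otimes> ?d = (((?b \<cdot> ?\<delta>) \<otimes> \<one> ?X) \<otimes> \<one> (?Z \<odot> ?Z)) \<cdot> (?\<delta> \<otimes> ?d)"
        by (simp add: s)
      also have "((?b \<cdot> ?\<delta>) \<otimes> \<one> ?X) \<otimes> \<one> (?Z \<odot> ?Z) = (?b \<cdot> ?\<delta>) \<otimes> \<one> (?X \<odot> ?Z \<odot> ?Z)"
        by (simp add: s tarr_assoc)
      finally have "(\<one> ?X \<otimes> \<one> ?X \<otimes> ?c \<otimes> \<one> ?Z) \<cdot> (?N \<otimes> ?d)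
          = (\<one> ?X \<otimes> \<one> ?X \<otimes> ?c \<otimes> \<one> ?Z) \<cdot> ((?b \<cdot> ?\<delta>) \<otimes> \<one> (?X \<odot> ?Z \<odot> ?Z)) \<cdot> (?\<delta> \<otimes> ?d)"
        by (rule arg_cong)
      also have r: "\<one> ?X \<otimes> \<one> ?X \<otimes> ?c \<otimes> \<one> ?Z = \<one> ?X2 \<otimes> ?c \<otimes> \<one> ?Z"
        by (simp add: s id_tarr_id_tarr)
      also have "(\<one> ?X2 \<otimes> ?c \<otimes> \<one> ?Z) \<cdot> ((?b \<cdot> ?\<delta>) \<otimes> \<one> (?X \<odot> ?Z \<odot> ?Z)) \<cdot> (?\<delta> \<otimes> ?d)
          = ((?b \<cdot> ?\<delta>) \<otimes> \<one> (?Z \<odot> ?X \<odot> ?Z)) \<cdot> (\<one> ?X \<otimes> ?c \<otimes> \<one> ?Z) \<cdot> (?\<delta> \<otimes> ?d)"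
        by (simp add: s)
      finally show ?thesis by (simp only: r)
    qed
    have "?l = (\<one> ?X2 \<otimes> ?c \<otimes> \<one> (?X \<odot> ?Z)) \<cdot> ((\<one> ?X \<otimes> ?b) \<otimes> \<one> (?Z \<odot> ?X \<odot> ?Z))
        \<cdot> (\<one> ?X3 \<otimes> (?c \<otimes> \<one> ?Z)) \<cdot> (?L \<otimes> ?d)"
      unfolding e1 e2 by (rule assoc) (simp_all add: s)
    also have "\<dots> = ?r"
      unfolding e3 comult_anticomult[OF D] e4 e5 e6 ..
    finally show ?thesis .
  qed
  have "comult B \<cdot> \<Phi> = (comult B \<cdot> ?P) \<cdot> (?\<delta> \<otimes> \<one> ?Z)"
    by (simp add: P s)
  also have "\<dots> = (?P \<otimes> ?P) \<cdot> (\<one> ?X \<otimes> \<c> ?X (?X \<odot> ?Z) \<otimes> \<one> (?X \<odot> ?Z))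
      \<cdot> ((?b \<cdot> ?\<delta>) \<otimes> ((\<one> ?X \<otimes> ?c \<otimes> \<one> ?Z) \<cdot> (?\<delta> \<otimes> ?d))) \<cdot> (?\<delta> \<otimes> \<one> ?Z)"
    unfolding comult_P by (simp add: s)
  also have "\<dots> = (?P \<otimes> ?P) \<cdot> (?\<delta> \<otimes> \<one> (?Z \<odot> ?X \<odot> ?X \<odot> ?Z)) \<cdot> (\<one> ?X \<otimes> ?c \<otimes> \<one> (?X \<odot> ?Z))
      \<cdot> ((?b \<cdot> ?\<delta>) \<otimes> \<one> (?Z \<odot> ?X \<odot> ?Z)) \<cdot> (\<one> ?X \<otimes> ?c \<otimes> \<one> ?Z) \<cdot> (?\<delta> \<otimes> ?d)" (is "_ = _ \<cdot> _ \<cdot> ?R")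
    unfolding rearrange ..
  also have "\<dots> = ((?P \<otimes> ?P) \<cdot> (?\<delta> \<otimes> \<one> (?Z \<odot> ?X \<odot> ?X \<odot> ?Z))) \<cdot> ?R"
    by (rule assoc[symmetric]) (simp_all add: s)
  \<comment> \<open>The comultiplication exposed by \<open>rearrange\<close> completes the first
    \<open>?P\<close> to \<open>\<Phi>\<close>.\<close>
  also have "(?P \<otimes> ?P) \<cdot> (?\<delta> \<otimes> \<one> (?Z \<odot> ?X \<odot> ?X \<odot> ?Z)) = \<Phi> \<otimes> ?P"
  proof -
    have "?\<delta> \<otimes> \<one> (?Z \<odot> ?X \<odot> ?X \<odot> ?Z) = (?\<delta> \<otimes> \<one> ?Z) \<otimes> \<one> (?X \<odot> ?X \<odot> ?Z)"
      by (simp add: s tarr_assoc)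
    then show ?thesis by (simp add: P s)
  qed
  \<comment> \<open>The second \<open>?P\<close> is set aside; together with the two rebracketings
    that follow, this isolates the left side of \<open>cocomm\<close> as a block tensored with the
    identity of the last two legs.\<close>
  also have "\<Phi> \<otimes> ?P = (\<one> ?Y \<otimes> ?P) \<cdot> ((\<Phi> \<otimes> \<one> ?X) \<otimes> \<one> (?X \<odot> ?Z))"
  proof -
    have "(\<Phi> \<otimes> \<one> ?X) \<otimes> \<one> (?X \<odot> ?Z) = \<Phi> \<otimes> \<one> (?X \<odot> ?X \<odot> ?Z)"
      by (simp add: s PX tarr_assoc)
    then show ?thesis by (simp add: s PX)
  qed
  also have "\<one> ?X \<otimes> ?c \<otimes> \<one> (?X \<odot> ?Z) = (\<one> ?X \<otimes> ?c) \<otimes> \<one> (?X \<odot> ?Z)"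
    by (simp add: s tarr_assoc)
  also have "(?b \<cdot> ?\<delta>) \<otimes> \<one> (?Z \<odot> ?X \<odot> ?Z) = ((?b \<cdot> ?\<delta>) \<otimes> \<one> ?Z) \<otimes> \<one> (?X \<odot> ?Z)"
    by (simp add: s tarr_assoc)
  also have "((\<one> ?Y \<otimes> ?P) \<cdot> ((\<Phi> \<otimes> \<one> ?X) \<otimes> \<one> (?X \<odot> ?Z))) \<cdot> ((\<one> ?X \<otimes> ?c) \<otimes> \<one> (?X \<odot> ?Z))
        \<cdot> (((?b \<cdot> ?\<delta>) \<otimes> \<one> ?Z) \<otimes> \<one> (?X \<odot> ?Z)) \<cdot> (\<one> ?X \<otimes> ?c \<otimes> \<one> ?Z) \<cdot> (?\<delta> \<otimes> ?d)
      = (\<one> ?Y \<otimes> ?P)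
        \<cdot> (((\<Phi> \<otimes> \<one> ?X) \<cdot> (\<one> ?X \<otimes> ?c) \<cdot> ((?b \<cdot> ?\<delta>) \<otimes> \<one> ?Z)) \<otimes> \<one> (?X \<odot> ?Z))
        \<cdot> (\<one> ?X \<otimes> ?c \<otimes> \<one> ?Z) \<cdot> (?\<delta> \<otimes> ?d)"
    by (simp add: s PX)
  also have "(\<Phi> \<otimes> \<one> ?X) \<cdot> (\<one> ?X \<otimes> ?c) \<cdot> ((?b \<cdot> ?\<delta>) \<otimes> \<one> ?Z)
      = (\<Phi> \<otimes> \<one> ?X) \<cdot> (\<one> ?X \<otimes> ?c) \<cdot> (?\<delta> \<otimes> \<one> ?Z)"
    by (rule cocomm)
  also have "(\<one> ?Y \<otimes> ?P) \<cdot> (((\<Phi> \<otimes> \<one> ?X) \<cdot> (\<one> ?X \<otimes> ?c) \<cdot> (?\<delta> \<otimes> \<one> ?Z)) \<otimes> \<one> (?X \<odot> ?Z))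
        \<cdot> (\<one> ?X \<otimes> ?c \<otimes> \<one> ?Z) \<cdot> (?\<delta> \<otimes> ?d)
      = ((\<one> ?Y \<otimes> ?P) \<cdot> ((\<Phi> \<otimes> \<one> ?X) \<otimes> \<one> (?X \<odot> ?Z))) \<cdot> ((\<one> ?X \<otimes> ?c) \<otimes> \<one> (?X \<odot> ?Z))
        \<cdot> ((?\<delta> \<otimes> \<one> ?Z) \<otimes> \<one> (?X \<odot> ?Z)) \<cdot> (\<one> ?X \<otimes> ?c \<otimes> \<one> ?Z) \<cdot> (?\<delta> \<otimes> ?d)"
    by (simp add: s PX)
  \<comment> \<open>After the exchange the legs are h1, b1, h2, h3, b2. Coassociativity makes h2 and
    h3 come from one comultiplication; the hexagon and naturality slide it past b1, next to the
    second \<open>?P\<close>, which it completes to \<open>\<Phi>\<close>.\<close>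
  also have "((\<one> ?X \<otimes> ?c) \<otimes> \<one> (?X \<odot> ?Z)) \<cdot> ((?\<delta> \<otimes> \<one> ?Z) \<otimes> \<one> (?X \<odot> ?Z))
        \<cdot> (\<one> ?X \<otimes> ?c \<otimes> \<one> ?Z) \<cdot> (?\<delta> \<otimes> ?d)
      = (\<one> ?X \<otimes> (\<one> ?Z \<otimes> ?\<delta>) \<otimes> \<one> ?Z) \<cdot> (\<one> ?X \<otimes> ?c \<otimes> \<one> ?Z) \<cdot> (?\<delta> \<otimes> ?d)"
  proof -
    have nat: "\<c> (?X \<odot> ?X) ?Z \<cdot> (?\<delta> \<otimes> \<one> ?Z) = (\<one> ?Z \<otimes> ?\<delta>) \<cdot> ?c"
      by (subst natural) (simp_all add: s)
    have "((?\<delta> \<otimes> \<one> ?Z) \<otimes> \<one> (?X \<odot> ?Z)) \<cdot> (\<one> ?X \<otimes> ?c \<otimes> \<one> ?Z) \<cdot> (?\<delta> \<otimes> ?d)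
        = (\<one> ?X \<otimes> (\<one> ?X \<otimes> ?c) \<otimes> \<one> ?Z) \<cdot> (\<one> ?X \<otimes> (?\<delta> \<otimes> \<one> ?Z) \<otimes> \<one> ?Z) \<cdot> (?\<delta> \<otimes> ?d)"
    proof -
      have "((?\<delta> \<otimes> \<one> ?Z) \<otimes> \<one> (?X \<odot> ?Z)) \<cdot> (\<one> ?X \<otimes> ?c \<otimes> \<one> ?Z) \<cdot> (?\<delta> \<otimes> ?d)
          = (?\<delta> \<otimes> ?c \<otimes> \<one> ?Z) \<cdot> (?\<delta> \<otimes> ?d)"
      proof -
        have "(?\<delta> \<otimes> \<one> ?Z) \<otimes> \<one> (?X \<odot> ?Z) = ?\<delta> \<otimes> \<one> (?Z \<odot> ?X \<odot> ?Z)"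
          by (simp add: s tarr_assoc)
        then show ?thesis by (simp add: s)
      qed
      also have "\<dots> = (\<one> (?X \<odot> ?X) \<otimes> ?c \<otimes> \<one> ?Z) \<cdot> (?\<delta> \<otimes> \<one> (?X \<odot> ?Z \<odot> ?Z)) \<cdot> (?\<delta> \<otimes> ?d)"
        by (simp add: s)
      also have "?\<delta> \<otimes> \<one> (?X \<odot> ?Z \<odot> ?Z) = (?\<delta> \<otimes> \<one> ?X) \<otimes> \<one> (?Z \<odot> ?Z)"
        by (simp add: s tarr_assoc)
      also have "((?\<delta> \<otimes> \<one> ?X) \<otimes> \<one> (?Z \<odot> ?Z)) \<cdot> (?\<delta> \<otimes> ?d) = ((?\<delta> \<otimes> \<one> ?X) \<cdot> ?\<delta>) \<otimes> ?d"
        by (simp add: s)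
      also have "\<dots> = ((\<one> ?X \<otimes> ?\<delta>) \<otimes> \<one> (?Z \<odot> ?Z)) \<cdot> (?\<delta> \<otimes> ?d)"
        unfolding ca by (simp add: s)
      also have "(\<one> ?X \<otimes> ?\<delta>) \<otimes> \<one> (?Z \<odot> ?Z) = \<one> ?X \<otimes> (?\<delta> \<otimes> \<one> ?Z) \<otimes> \<one> ?Z"
        by (simp add: s tarr_assoc)
      also have "\<one> (?X \<odot> ?X) \<otimes> ?c \<otimes> \<one> ?Z = \<one> ?X \<otimes> (\<one> ?X \<otimes> ?c) \<otimes> \<one> ?Z"
        by (simp add: s tarr_assoc id_tarr_id_tarr)
      finally show ?thesis .
    qed
    moreover have "(\<one> ?X \<otimes> ?c) \<otimes> \<one> (?X \<odot> ?Z) = \<one> ?X \<otimes> (?c \<otimes> \<one> ?X) \<otimes> \<one> ?Z"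
      by (simp add: s tarr_assoc)
    ultimately have "((\<one> ?X \<otimes> ?c) \<otimes> \<one> (?X \<odot> ?Z)) \<cdot> ((?\<delta> \<otimes> \<one> ?Z) \<otimes> \<one> (?X \<odot> ?Z))
        \<cdot> (\<one> ?X \<otimes> ?c \<otimes> \<one> ?Z) \<cdot> (?\<delta> \<otimes> ?d)
      = (\<one> ?X \<otimes> (?c \<otimes> \<one> ?X) \<otimes> \<one> ?Z) \<cdot> (\<one> ?X \<otimes> (\<one> ?X \<otimes> ?c) \<otimes> \<one> ?Z)
        \<cdot> (\<one> ?X \<otimes> (?\<delta> \<otimes> \<one> ?Z) \<otimes> \<one> ?Z) \<cdot> (?\<delta> \<otimes> ?d)"
      by (simp only:)
    also have "\<dots> = (\<one> ?X \<otimes> (\<c> (?X \<odot> ?X) ?Z \<cdot> (?\<delta> \<otimes> \<one> ?Z)) \<otimes> \<one> ?Z) \<cdot> (?\<delta> \<otimes> ?d)"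
      by (simp add: s hexagon_left)
    finally show ?thesis unfolding nat by (simp add: s)
  qed
  also have "((\<one> ?Y \<otimes> ?P) \<cdot> ((\<Phi> \<otimes> \<one> ?X) \<otimes> \<one> (?X \<odot> ?Z)))
        \<cdot> (\<one> ?X \<otimes> (\<one> ?Z \<otimes> ?\<delta>) \<otimes> \<one> ?Z) \<cdot> (\<one> ?X \<otimes> ?c \<otimes> \<one> ?Z) \<cdot> (?\<delta> \<otimes> ?d)
      = (\<Phi> \<otimes> \<Phi>) \<cdot> (\<one> ?X \<otimes> ?c \<otimes> \<one> ?Z) \<cdot> (?\<delta> \<otimes> ?d)" (is "_ \<cdot> ?K = _ \<cdot> ?Q")
  proof -
    have "(\<Phi> \<otimes> \<one> ?X) \<otimes> \<one> (?X \<odot> ?Z) = \<Phi> \<otimes> \<one> (?X \<odot> ?X \<odot> ?Z)"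
      by (simp add: s PX tarr_assoc)
    moreover have "\<one> ?X \<otimes> (\<one> ?Z \<otimes> ?\<delta>) \<otimes> \<one> ?Z = \<one> (?X \<odot> ?Z) \<otimes> (?\<delta> \<otimes> \<one> ?Z)"
      by (simp add: s tarr_assoc id_tarr_id_tarr)
    moreover have "((\<one> ?Y \<otimes> ?P) \<cdot> (\<Phi> \<otimes> \<one> (?X \<odot> ?X \<odot> ?Z))) \<cdot> (\<one> (?X \<odot> ?Z) \<otimes> (?\<delta> \<otimes> \<one> ?Z)) \<cdot> ?Q
        = (\<Phi> \<otimes> (?P \<cdot> (?\<delta> \<otimes> \<one> ?Z))) \<cdot> ?Q"
      by (simp add: s PX)
    moreover have "?P \<cdot> (?\<delta> \<otimes> \<one> ?Z) = \<Phi>"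
      by (simp add: s P)
    ultimately show ?thesis by (simp only:)
  qed
  finally show ?thesis
    using counit by (simp add: coalgebra_morphism_def tensor_coalgebra_def homI PX)
qed

section \<open>Hopf bracoids\<close>

text \<open>Inserting the unit of \<open>B\<close> is compatible with the coalgebra structures: the
  unit is grouplike, and it passes the braiding because crossing \<open>\<K>\<close> is trivial.
  Composing with \<open>\<phi>\<close> preserves this.\<close>

lemma bracoid_u_coalgebra_morphism:
  assumes H: "is_coalgebra C H" and B: "is_hopf_algebra C B"
    and f: "coalgebra_morphism C (tensor_coalgebra C H B) B \<phi>"
  shows "coalgebra_morphism C H B (bracoid_u C H B \<phi>)"
proof -
  let ?X = "ob H" and ?Y = "ob B" and ?\<delta> = "comult H" and ?\<eta> = "unit B"
  let ?c = "\<c> ?X ?Y"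
  have h: "\<phi> \<in> Arr C" "Dom C \<phi> = ?X \<odot> ?Y" "Cod C \<phi> = ?Y"
    using f by (auto simp: hom_def coalgebra_morphism_def tensor_coalgebra_def)
  note s = br_simps coalgebra_arr[OF H] hopf_algebra_arr[OF B] h
  have f\<epsilon>: "counit B \<cdot> \<phi> = counit H \<otimes> counit B"
    and f\<delta>: "comult B \<cdot> \<phi> = (\<phi> \<otimes> \<phi>) \<cdot> (\<one> ?X \<otimes> ?c \<otimes> \<one> ?Y) \<cdot> (?\<delta> \<otimes> comult B)"
    using f by (simp_all add: coalgebra_morphism_def tensor_coalgebra_def)
  have "counit B \<cdot> \<phi> \<cdot> (\<one> ?X \<otimes> ?\<eta>) = (counit B \<cdot> \<phi>) \<cdot> (\<one> ?X \<otimes> ?\<eta>)"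
    by (simp add: s)
  also have "\<dots> = counit H"
    unfolding f\<epsilon> by (simp add: s hopf_counit_unit[OF B])
  finally have counit: "counit B \<cdot> \<phi> \<cdot> (\<one> ?X \<otimes> ?\<eta>) = counit H" .
  have nat: "?c \<cdot> (\<one> ?X \<otimes> ?\<eta>) = ?\<eta> \<otimes> \<one> ?X"
    using natural[of "\<one> ?X" ?\<eta> ?X ?Y] by (simp add: s braid_unit_right)
  have "comult B \<cdot> \<phi> \<cdot> (\<one> ?X \<otimes> ?\<eta>) = (comult B \<cdot> \<phi>) \<cdot> (\<one> ?X \<otimes> ?\<eta>)"
    by (simp add: s)
  also have "\<dots> = (\<phi> \<otimes> \<phi>) \<cdot> (\<one> ?X \<otimes> ?c \<otimes> \<one> ?Y) \<cdot> (?\<delta> \<otimes> (?\<eta> \<otimes> ?\<eta>))"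
    unfolding f\<delta> by (simp add: s hopf_comult_unit[OF B])
  \<comment> \<open>The two units are moved above the comultiplication and regrouped so that one of
    them faces the inner braiding.\<close>
  also have "?\<delta> \<otimes> (?\<eta> \<otimes> ?\<eta>) = (\<one> ?X \<otimes> (\<one> ?X \<otimes> ?\<eta>) \<otimes> ?\<eta>) \<cdot> ?\<delta>"
  proof -
    have "?\<delta> \<otimes> (?\<eta> \<otimes> ?\<eta>) = (\<one> (?X \<odot> ?X) \<otimes> (?\<eta> \<otimes> ?\<eta>)) \<cdot> ?\<delta>"
      using interchange[of "\<one> (?X \<odot> ?X)" ?\<delta> "?\<eta> \<otimes> ?\<eta>" "\<one> \<K>"] by (simp add: s)
    also have "\<one> (?X \<odot> ?X) \<otimes> (?\<eta> \<otimes> ?\<eta>) = \<one> ?X \<otimes> (\<one> ?X \<otimes> ?\<eta>) \<otimes> ?\<eta>"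
      by (simp add: s tarr_assoc id_tarr_id_tarr)
    finally show ?thesis .
  qed
  also have "(\<phi> \<otimes> \<phi>) \<cdot> (\<one> ?X \<otimes> ?c \<otimes> \<one> ?Y) \<cdot> (\<one> ?X \<otimes> (\<one> ?X \<otimes> ?\<eta>) \<otimes> ?\<eta>) \<cdot> ?\<delta>
      = (\<phi> \<otimes> \<phi>) \<cdot> (\<one> ?X \<otimes> (?\<eta> \<otimes> \<one> ?X) \<otimes> ?\<eta>) \<cdot> ?\<delta>"
    by (simp add: s nat)
  also have "\<one> ?X \<otimes> (?\<eta> \<otimes> \<one> ?X) \<otimes> ?\<eta> = (\<one> ?X \<otimes> ?\<eta>) \<otimes> (\<one> ?X \<otimes> ?\<eta>)"
    by (simp add: s tarr_assoc)
  finally have "comult B \<cdot> \<phi> \<cdot> (\<one> ?X \<otimes> ?\<eta>)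
      = ((\<phi> \<cdot> (\<one> ?X \<otimes> ?\<eta>)) \<otimes> (\<phi> \<cdot> (\<one> ?X \<otimes> ?\<eta>))) \<cdot> ?\<delta>"
    by (simp add: s)
  with counit show ?thesis
    by (simp add: coalgebra_morphism_def bracoid_u_def homI s)
qed

text \<open>Naturality of the braiding moves \<open>u \<otimes> u\<close> past the crossing in
  \<open>comult_antipode\<close>. The two conclusions are the conditions on \<open>\<sigma>\<close>
  in \<open>anticomult_product_coalgebra_morphism\<close>.\<close>

lemma antipode_comp_anticoalgebra:
  assumes H: "is_coalgebra C H" and B: "is_hopf_algebra C B" and u: "coalgebra_morphism C H B u"
  shows "counit B \<cdot> antipode B \<cdot> u = counit H"
    and "comult B \<cdot> antipode B \<cdot> u
      = ((antipode B \<cdot> u) \<otimes> (antipode B \<cdot> u)) \<cdot> \<c> (ob H) (ob H) \<cdot> comult H"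
proof -
  have h: "u \<in> Arr C" "Dom C u = ob H" "Cod C u = ob B"
    and u\<epsilon>: "counit B \<cdot> u = counit H" and u\<delta>: "comult B \<cdot> u = (u \<otimes> u) \<cdot> comult H"
    using u by (auto simp: hom_def coalgebra_morphism_def)
  note s = br_simps coalgebra_arr[OF H] hopf_algebra_arr[OF B] h
  let ?S = "antipode B"
  have "counit B \<cdot> ?S \<cdot> u = (counit B \<cdot> ?S) \<cdot> u"
    by (simp add: s)
  then show "counit B \<cdot> ?S \<cdot> u = counit H"
    by (simp only: counit_antipode[OF B] u\<epsilon>)
  have nat: "\<c> (ob B) (ob B) \<cdot> (u \<otimes> u) = (u \<otimes> u) \<cdot> \<c> (ob H) (ob H)"
    by (subst natural) (simp_all add: s)
  have "comult B \<cdot> ?S \<cdot> u = (comult B \<cdot> ?S) \<cdot> u"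
    by (simp add: s)
  also have "\<dots> = (?S \<otimes> ?S) \<cdot> \<c> (ob B) (ob B) \<cdot> (comult B \<cdot> u)"
    unfolding comult_antipode[OF B] by (simp add: s)
  also have "\<dots> = (?S \<otimes> ?S) \<cdot> (\<c> (ob B) (ob B) \<cdot> (u \<otimes> u)) \<cdot> comult H"
    unfolding u\<delta> by (simp add: s)
  finally show "comult B \<cdot> ?S \<cdot> u = ((?S \<cdot> u) \<otimes> (?S \<cdot> u)) \<cdot> \<c> (ob H) (ob H) \<cdot> comult H"
    unfolding nat by (simp add: s)
qed

end

theorem lemma2p20:
  fixes C :: "('o, 'm) braided_data" (structure)
    and H B :: "('o, 'm) hopf"
    and \<phi> :: "'m"
  assumes "strict_braided_monoidal_category C"
    and "hopf_bracoid C H B \<phi>"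
    and "coalgebra_morphism C (tensor_coalgebra C H B) B \<phi>"
    and "(bracoid_Phi C H B \<phi> \<otimes> \<one> (ob H)) \<cdot> (\<one> (ob H) \<otimes> \<c> (ob H) (ob B))
            \<cdot> ((\<c> (ob H) (ob H) \<cdot> comult H) \<otimes> \<one> (ob B))
         = (bracoid_Phi C H B \<phi> \<otimes> \<one> (ob H)) \<cdot> (\<one> (ob H) \<otimes> \<c> (ob H) (ob B))
            \<cdot> (comult H \<otimes> \<one> (ob B))"
  shows "coalgebra_morphism C (tensor_coalgebra C H B) B (bracoid_Phi C H B \<phi>)"
proof -
  interpret strict_braided_monoidal_category C by fact
  have B: "is_hopf_algebra C B" and H: "is_coalgebra C H" and Bc: "is_coalgebra C B"
    using assms(2) by (simp_all add: hopf_bracoid_def is_hopf_algebra_def)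
  note u = bracoid_u_coalgebra_morphism[OF H B assms(3)]
  have "antipode B \<cdot> bracoid_u C H B \<phi> \<in> hom C (ob H) (ob B)"
    using u B by (auto simp: coalgebra_morphism_def is_hopf_algebra_def intro: comp_hom)
  \<comment> \<open>Here \<open>\<sigma>\<close> is
    \<open>antipode B \<cdot> bracoid_u C H B \<phi>\<close>, with \<open>H\<close> for
    \<open>D\<close> and \<open>B\<close> for \<open>E\<close>; \<open>bracoid_Phi_def\<close> is
    then the required product formula for \<open>\<Phi>\<close>.\<close>
  then show ?thesis
    by (rule anticomult_product_coalgebra_morphism[OF H Bc B _ antipode_comp_anticoalgebra[OF H B u]
          assms(3) bracoid_Phi_def assms(4)])
qed

end
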